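(* There are implementations of the operations $\mathsf{add}(o)\to v'$ (for $o\in\Omega$), $\mathsf{prod}(v_1,v_2)\to v'$, $\mathsf{union}(v_3,v_4)\to v'$ and $\mathsf{shift}(v,k)\to v'$ (for $k\in\mathbb{Z}$) on Shift-ECSs that each take constant time and are fully persistent (they only add fresh nodes and never modify existing ones, so $[\![\mathcal{D}]\!](u)$ is unchanged for every pre-existing node $u$). Furthermore, if one starts from an empty Shift-ECS $\mathcal{D}$ and applies these operations only to safe nodes, then the resulting node $v'$ is always safe, and for every node $v$ of the resulting structure the set $[\![\mathcal{D}]\!](v)$ can be enumerated with output-linear delay without preprocessing.
   Context: Let $\Omega$ be a finite output alphabet disjoint from $\mathbb{Z}$ and from $\{\cup,\odot\}$. A Shift-ECS is a tuple $\mathcal{D}=(\Omega,V,\ell,r,\lambda)$ with $V$ a finite set of nodes, $\ell,r$ partial functions $V\to V$, $\lambda:V\to\Omega\cup\mathbb{Z}\cup\{\cup,\odot\}$, the graph of $\ell,r$ acyclic, $\ell(v)$ defined iff $\lambda(v)\in\mathbb{Z}\cup\{\cup,\odot\}$, $r(v)$ defined iff $\lambda(v)\in\{\cup,\odot\}$. Nodes with label in $\Omega$ are bottom nodes, label $\odot$ product nodes, label $\cup$ union nodes, label in $\mathbb{Z}$ shift nodes; bottom and product nodes are called output nodes. With $\mathsf{sh}((o,i),k)=(o,i+k)$ extended to strings and sets of strings, each node denotes a set $[\![\mathcal{D}]\!](v)$ of strings over $\Omega\times\mathbb{Z}$: $\{(o,1)\}$ for a bottom node labelled $o$; the union of the children's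 sets for a union node; the concatenation $[\![\mathcal{D}]\!](\ell(v))\cdot[\![\mathcal{D}]\!](r(v))$ for a product node; $\mathsf{sh}([\![\mathcal{D}]\!](\ell(v)),\lambda(v))$ for a shift node. Output-depth: $\mathsf{odepth}(v)=0$ for output nodes, $\mathsf{odepth}(\ell(v))+1$ for union and shift nodes. A node $v$ is safe if $v$ is a shift node and either $\ell(v)$ is an output node, or $u=\ell(v)$ is a union node with $\mathsf{odepth}(u)=1$ and $r(u)$ is a shift node with $\mathsf{odepth}(r(u))\le 2$. The operations extend $\mathcal{D}$ with fresh nodes and return a fresh node $v'$ with: $[\![\mathcal{D}]\!](v')=\{(o,1)\}$ for $\mathsf{add}(o)$; $[\![\mathcal{D}]\!](v_1)\cdot[\![\mathcal{D}]\!](v_2)$ for $\mathsf{prod}(v_1,v_2)$; $[\![\mathcal{D}]\!](v_3)\cup[\![\mathcal{D}]\!](v_4)$ for $\mathsf{union}(v_3,v_4)$; $\mathsf{sh}([\![\mathcal{D}]\!](v),k)$ for $\mathsf{shift}(v,k)$. It is assumed that $\mathsf{union}$ is only applied when $[\![\mathcal{D}]\!](v_3)\cap[\![\mathcal{D}]\!](v_4)=\emptyset$, and $\mathsf{prod}$ only when every $w\in[\![\mathcal{D}]\!](v_1)\cdot[\![\mathcal{D}]\!](v_2)$ decomposes uniquely as $w_1w_2$ with $w_1\in[\![\mathcal{D}]\!](v_1)$, $w_2\in[\![\mathcal{D}]\!](v_2)$. Output-linear delay: the time before the first output, between consecutive outputs, and after the last output is linear in the size of the next output (constant at the end). *)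

theory Defs
  imports Main
begin

text \<open>The datatype makes \<open>\<Omega>\<close>, the integers and the two operator symbols disjoint.\<close>

datatype 'o label = LBottom 'o | LShift int | LUnion | LProd

record ('o, 'v) ecs =
  alphabet :: "'o set"
  nodes :: "'v set"
  left :: "'v \<Rightarrow> 'v option"
  right :: "'v \<Rightarrow> 'v option"
  lab :: "'v \<Rightarrow> 'o label"

definition children :: "('o, 'v) ecs \<Rightarrow> ('v \<times> 'v) set" where
  "children D = {(v, u). left D v = Some u \<or> right D v = Some u}"

definition shift_ecs :: "('o, 'v) ecs \<Rightarrow> bool" where
  "shift_ecs D \<longleftrightarrow>
     finite (alphabet D) \<and> finite (nodes D) \<and>
     children D \<subseteq> nodes D \<times> nodes D \<and> acyclic (children D) \<and>
     (\<forall>v \<in> nodes D.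
        lab D v \<in> LBottom ` alphabet D \<union> range LShift \<union> {LUnion, LProd} \<and>
        (left D v \<noteq> None \<longleftrightarrow> lab D v \<in> range LShift \<union> {LUnion, LProd}) \<and>
        (right D v \<noteq> None \<longleftrightarrow> lab D v \<in> {LUnion, LProd}))"

definition bottom_node :: "('o, 'v) ecs \<Rightarrow> 'v \<Rightarrow> bool" where
  "bottom_node D v \<longleftrightarrow> v \<in> nodes D \<and> lab D v \<in> range LBottom"

definition product_node :: "('o, 'v) ecs \<Rightarrow> 'v \<Rightarrow> bool" where
  "product_node D v \<longleftrightarrow> v \<in> nodes D \<and> lab D v = LProd"

definition union_node :: "('o, 'v) ecs \<Rightarrow> 'v \<Rightarrow> bool" where
  "union_node D v \<longleftrightarrow> v \<in> nodes D \<and> lab D v = LUnion"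

definition shift_node :: "('o, 'v) ecs \<Rightarrow> 'v \<Rightarrow> bool" where
  "shift_node D v \<longleftrightarrow> v \<in> nodes D \<and> lab D v \<in> range LShift"

definition output_node :: "('o, 'v) ecs \<Rightarrow> 'v \<Rightarrow> bool" where
  "output_node D v \<longleftrightarrow> bottom_node D v \<or> product_node D v"

abbreviation lchild :: "('o, 'v) ecs \<Rightarrow> 'v \<Rightarrow> 'v" where
  "lchild D v \<equiv> the (left D v)"

abbreviation rchild :: "('o, 'v) ecs \<Rightarrow> 'v \<Rightarrow> 'v" where
  "rchild D v \<equiv> the (right D v)"

definition sh :: "('o \<times> int) list set \<Rightarrow> int \<Rightarrow> ('o \<times> int) list set" where
  "sh L k = map (\<lambda>(x, i). (x, i + k)) ` L"

definition conc :: "'c list set \<Rightarrow> 'c list set \<Rightarrow> 'c list set" where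
  "conc A B = {xs @ ys | xs ys. xs \<in> A \<and> ys \<in> B}"

text \<open>The two recursions below run along the graph of \<open>left\<close> and \<open>right\<close>; they terminate
  for the nodes of a Shift-ECS by acyclicity, and the defining equations are unconditional there
  (lemmas \<open>den_simp\<close> and \<open>odepth_simp\<close>).\<close>

function (domintros) den :: "('o, 'v) ecs \<Rightarrow> 'v \<Rightarrow> ('o \<times> int) list set" where
  "den D v = (case lab D v of
      LBottom x \<Rightarrow> {[(x, 1)]}
    | LUnion \<Rightarrow> den D (lchild D v) \<union> den D (rchild D v)
    | LProd \<Rightarrow> conc (den D (lchild D v)) (den D (rchild D v))
    | LShift k \<Rightarrow> sh (den D (lchild D v)) k)"
  by pat_completeness auto

function (domintros) odepth :: "('o, 'v) ecs \<Rightarrow> 'v \<Rightarrow> nat" where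
  "odepth D v = (if output_node D v then 0 else odepth D (lchild D v) + 1)"
  by pat_completeness auto

definition safe :: "('o, 'v) ecs \<Rightarrow> 'v \<Rightarrow> bool" where
  "safe D v \<longleftrightarrow> shift_node D v \<and>
     (output_node D (lchild D v) \<or>
      (let u = lchild D v in
         union_node D u \<and> odepth D u = 1 \<and>
         shift_node D (rchild D u) \<and> odepth D (rchild D u) \<le> 2))"

lemma shift_ecs_wf:
  assumes "shift_ecs D"
  shows "wf ((children D)\<inverse>)"
proof (rule finite_acyclic_wf_converse)
  show "finite (children D)"
    using assms finite_subset[of "children D" "nodes D \<times> nodes D"]
    by (auto simp: shift_ecs_def)
  show "acyclic (children D)"
    using assms by (simp add: shift_ecs_def)
qed

lemma shift_ecs_left:
  assumes "shift_ecs D" "v \<in> nodes D" "\<not> bottom_node D v"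
  shows "left D v = Some (lchild D v)" "lchild D v \<in> nodes D" "(v, lchild D v) \<in> children D"
proof -
  from assms show *: "left D v = Some (lchild D v)"
    unfolding shift_ecs_def bottom_node_def by (cases "lab D v"; fastforce)
  then show "(v, lchild D v) \<in> children D"
    by (simp add: children_def)
  then show "lchild D v \<in> nodes D"
    using assms(1) by (auto simp: shift_ecs_def)
qed

lemma shift_ecs_right:
  assumes "shift_ecs D" "v \<in> nodes D" "union_node D v \<or> product_node D v"
  shows "right D v = Some (rchild D v)" "rchild D v \<in> nodes D" "(v, rchild D v) \<in> children D"
proof -
  from assms show *: "right D v = Some (rchild D v)"
    unfolding shift_ecs_def union_node_def product_node_def by fastforce
  then show "(v, rchild D v) \<in> children D"
    by (simp add: children_def)
  then show "rchild D v \<in> nodes D"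
    using assms(1) by (auto simp: shift_ecs_def)
qed

lemma den_dom:
  assumes "shift_ecs D"
  shows "v \<in> nodes D \<Longrightarrow> den_dom (D, v)"
proof (induction v rule: wf_induct_rule[OF shift_ecs_wf[OF assms]])
  case (1 v)
  show ?case
  proof (rule den.domintros)
  qed (use 1 shift_ecs_left[OF assms, of v] shift_ecs_right[OF assms, of v] in
      \<open>auto simp: bottom_node_def union_node_def product_node_def\<close>)
qed

lemma den_simp:
  assumes "shift_ecs D" "v \<in> nodes D"
  shows "den D v = (case lab D v of
      LBottom x \<Rightarrow> {[(x, 1)]}
    | LUnion \<Rightarrow> den D (lchild D v) \<union> den D (rchild D v)
    | LProd \<Rightarrow> conc (den D (lchild D v)) (den D (rchild D v))
    | LShift k \<Rightarrow> sh (den D (lchild D v)) k)"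
  by (rule den.psimps[OF den_dom[OF assms]])

lemma odepth_dom:
  assumes "shift_ecs D"
  shows "v \<in> nodes D \<Longrightarrow> odepth_dom (D, v)"
proof (induction v rule: wf_induct_rule[OF shift_ecs_wf[OF assms]])
  case (1 v)
  show ?case
  proof (rule odepth.domintros)
  qed (use 1 shift_ecs_left[OF assms, of v] in \<open>auto simp: output_node_def\<close>)
qed

lemma odepth_simp:
  assumes "shift_ecs D" "v \<in> nodes D"
  shows "odepth D v = (if output_node D v then 0 else odepth D (lchild D v) + 1)"
  by (rule odepth.psimps[OF odepth_dom[OF assms]])

datatype ('o, 'v) request = Add 'o | Prod 'v 'v | Union 'v 'v | Shift 'v int

datatype kind = KAdd | KProd | KUnion | KShift

fun kind_of :: "('o, 'v) request \<Rightarrow> kind" where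
  "kind_of (Add x) = KAdd"
| "kind_of (Prod v w) = KProd"
| "kind_of (Union v w) = KUnion"
| "kind_of (Shift v k) = KShift"

fun arg_nodes :: "('o, 'v) request \<Rightarrow> 'v set" where
  "arg_nodes (Add x) = {}"
| "arg_nodes (Prod v w) = {v, w}"
| "arg_nodes (Union v w) = {v, w}"
| "arg_nodes (Shift v k) = {v}"

definition unambiguous :: "'c list set \<Rightarrow> 'c list set \<Rightarrow> bool" where
  "unambiguous A B \<longleftrightarrow>
     (\<forall>w \<in> conc A B. \<exists>!p. fst p \<in> A \<and> snd p \<in> B \<and> w = fst p @ snd p)"

fun admissible :: "('o, 'v) ecs \<Rightarrow> ('o, 'v) request \<Rightarrow> bool" where
  "admissible D (Add x) \<longleftrightarrow> x \<in> alphabet D"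
| "admissible D (Prod v w) \<longleftrightarrow>
     v \<in> nodes D \<and> w \<in> nodes D \<and> unambiguous (den D v) (den D w)"
| "admissible D (Union v w) \<longleftrightarrow>
     v \<in> nodes D \<and> w \<in> nodes D \<and> den D v \<inter> den D w = {}"
| "admissible D (Shift v k) \<longleftrightarrow> v \<in> nodes D"

fun result_set :: "('o, 'v) ecs \<Rightarrow> ('o, 'v) request \<Rightarrow> ('o \<times> int) list set" where
  "result_set D (Add x) = {[(x, 1)]}"
| "result_set D (Prod v w) = conc (den D v) (den D w)"
| "result_set D (Union v w) = den D v \<union> den D w"
| "result_set D (Shift v k) = sh (den D v) k"

definition extends :: "('o, 'v) ecs \<Rightarrow> ('o, 'v) ecs \<Rightarrow> bool" where
  "extends D D' \<longleftrightarrow> alphabet D' = alphabet D \<and> nodes D \<subseteq> nodes D' \<and>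
     (\<forall>v \<in> nodes D. left D' v = left D v \<and> right D' v = right D v \<and> lab D' v = lab D v)"

inductive safely_built ::
  "(('o, 'v) ecs \<Rightarrow> ('o, 'v) request \<Rightarrow> ('o, 'v) ecs \<times> 'v) \<Rightarrow> 'o set \<Rightarrow> ('o, 'v) ecs \<Rightarrow> bool"
  for impl \<Omega> where
  empty: "\<lbrakk>shift_ecs D; alphabet D = \<Omega>; nodes D = {}\<rbrakk> \<Longrightarrow> safely_built impl \<Omega> D"
| apply_request: "\<lbrakk>safely_built impl \<Omega> D; admissible D q; \<forall>v \<in> arg_nodes q. safe D v\<rbrakk>
    \<Longrightarrow> safely_built impl \<Omega> (fst (impl D q))"

text \<open>A RAM with uniform cost measure whose arithmetic is addition and subtraction. The output
  tape is a sequence of records, each a string of pairs of integers: \<open>Write\<close> appends a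
  pair to the record under construction and \<open>Flush\<close> is the separator that completes it. The machine
  halts by leaving its program.\<close>

datatype instr =
    Const nat int
  | Move nat nat
  | Plus nat nat nat
  | Minus nat nat nat
  | Load nat nat
  | Store nat nat
  | Jump nat
  | JumpZero nat nat
  | JumpPos nat nat
  | Write nat nat
  | Flush

type_synonym program = "instr list"

record state =
  pc :: nat
  regs :: "nat \<Rightarrow> int"
  mem :: "int \<Rightarrow> int"
  buf :: "(int \<times> int) list"
  outs :: "(int \<times> int) list list"

fun exec :: "instr \<Rightarrow> state \<Rightarrow> state" where
  "exec (Const r k) s = s\<lparr>pc := pc s + 1, regs := (regs s)(r := k)\<rparr>"
| "exec (Move r a) s = s\<lparr>pc := pc s + 1, regs := (regs s)(r := regs s a)\<rparr>"
| "exec (Plus r a b) s = s\<lparr>pc := pc s + 1, regs := (regs s)(r := regs s a + regs s b)\<rparr>"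
| "exec (Minus r a b) s = s\<lparr>pc := pc s + 1, regs := (regs s)(r := regs s a - regs s b)\<rparr>"
| "exec (Load r a) s = s\<lparr>pc := pc s + 1, regs := (regs s)(r := mem s (regs s a))\<rparr>"
| "exec (Store r a) s = s\<lparr>pc := pc s + 1, mem := (mem s)(regs s r := regs s a)\<rparr>"
| "exec (Jump l) s = s\<lparr>pc := l\<rparr>"
| "exec (JumpZero r l) s = s\<lparr>pc := if regs s r = 0 then l else pc s + 1\<rparr>"
| "exec (JumpPos r l) s = s\<lparr>pc := if regs s r > 0 then l else pc s + 1\<rparr>"
| "exec (Write r a) s = s\<lparr>pc := pc s + 1, buf := buf s @ [(regs s r, regs s a)]\<rparr>"
| "exec Flush s = s\<lparr>pc := pc s + 1, buf := [], outs := outs s @ [buf s]\<rparr>"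

definition halted :: "program \<Rightarrow> state \<Rightarrow> bool" where
  "halted P s \<longleftrightarrow> pc s \<ge> length P"

definition step :: "program \<Rightarrow> state \<Rightarrow> state" where
  "step P s = (if halted P s then s else exec (P ! pc s) s)"

definition run :: "program \<Rightarrow> nat \<Rightarrow> state \<Rightarrow> state" where
  "run P n s = (step P ^^ n) s"

definition start :: "(nat \<Rightarrow> int) \<Rightarrow> (int \<Rightarrow> int) \<Rightarrow> state" where
  "start R M = \<lparr>pc = 0, regs = R, mem = M, buf = [], outs = []\<rparr>"

definition completion_time :: "program \<Rightarrow> state \<Rightarrow> nat \<Rightarrow> nat" where
  "completion_time P s i = (LEAST n. length (outs (run P n s)) \<ge> i)"

text \<open>In particular \<open>completion_time P s 0 = 0\<close>, so the bound for \<open>i = 0\<close> is the delay before the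
  first output, and there is no preprocessing phase.\<close>

definition enumerates_output_linear ::
  "program \<Rightarrow> nat \<Rightarrow> state \<Rightarrow> (int \<times> int) list set \<Rightarrow> bool" where
  "enumerates_output_linear P c s W \<longleftrightarrow>
     (\<exists>ws T. distinct ws \<and> set ws = W \<and>
        halted P (run P T s) \<and> outs (run P T s) = ws \<and> buf (run P T s) = [] \<and>
        (\<forall>i < length ws.
           completion_time P s (Suc i) \<le> completion_time P s i + c * length (ws ! i)) \<and>
        T \<le> completion_time P s (length ws) + c)"

fun tag :: "'o label \<Rightarrow> int" where
  "tag (LBottom x) = 0"
| "tag LProd = 1"
| "tag LUnion = 2"
| "tag (LShift k) = 3"

text \<open>Node \<open>v\<close> occupies the four cells from address \<open>addr v\<close>: tag, symbol code or
  shift, left pointer, right pointer. Cell \<open>0\<close> holds the first free address; nothing is assumed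
  about the cells from there on.\<close>

definition stores ::
  "('o \<Rightarrow> int) \<Rightarrow> ('v \<Rightarrow> int) \<Rightarrow> ('o, 'v) ecs \<Rightarrow> (int \<Rightarrow> int) \<Rightarrow> bool" where
  "stores enc addr D M \<longleftrightarrow> 0 < M 0 \<and>
     (\<forall>v \<in> nodes D.
        0 < addr v \<and> addr v + 4 \<le> M 0 \<and>
        M (addr v) = tag (lab D v) \<and>
        (\<forall>x. lab D v = LBottom x \<longrightarrow> M (addr v + 1) = enc x) \<and>
        (\<forall>k. lab D v = LShift k \<longrightarrow> M (addr v + 1) = k) \<and>
        (\<forall>u. left D v = Some u \<longrightarrow> M (addr v + 2) = addr u) \<and>
        (\<forall>u. right D v = Some u \<longrightarrow> M (addr v + 3) = addr u)) \<and>
     (\<forall>u \<in> nodes D. \<forall>v \<in> nodes D.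
        u \<noteq> v \<longrightarrow> addr u + 4 \<le> addr v \<or> addr v + 4 \<le> addr u)"

text \<open>Arguments are passed in registers 0 and 1; all other registers start with arbitrary contents.\<close>

fun passes :: "('o \<Rightarrow> int) \<Rightarrow> ('v \<Rightarrow> int) \<Rightarrow> ('o, 'v) request \<Rightarrow> (nat \<Rightarrow> int) \<Rightarrow> bool" where
  "passes enc addr (Add x) R \<longleftrightarrow> R 0 = enc x"
| "passes enc addr (Prod v w) R \<longleftrightarrow> R 0 = addr v \<and> R 1 = addr w"
| "passes enc addr (Union v w) R \<longleftrightarrow> R 0 = addr v \<and> R 1 = addr w"
| "passes enc addr (Shift v k) R \<longleftrightarrow> R 0 = addr v \<and> R 1 = k"

definition encode_string :: "('o \<Rightarrow> int) \<Rightarrow> ('o \<times> int) list \<Rightarrow> (int \<times> int) list" where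
  "encode_string enc w = map (\<lambda>(x, i). (enc x, i)) w"

definition performs ::
  "('o \<Rightarrow> int) \<Rightarrow> program \<Rightarrow> nat \<Rightarrow> ('o, 'v) ecs \<Rightarrow> ('o, 'v) request \<Rightarrow> ('o, 'v) ecs \<Rightarrow> 'v \<Rightarrow> bool"
  where
  "performs enc P c D q D' v' \<longleftrightarrow>
     (\<forall>addr M R. stores enc addr D M \<and> passes enc addr q R \<longrightarrow>
        (\<exists>n \<le> c. \<exists>addr'. let s = run P n (start R M) in
           halted P s \<and> stores enc addr' D' (mem s) \<and>
           (\<forall>u \<in> nodes D. addr' u = addr u) \<and> regs s 0 = addr' v'))"

definition enumerable ::
  "('o \<Rightarrow> int) \<Rightarrow> program \<Rightarrow> nat \<Rightarrow> ('o, 'v) ecs \<Rightarrow> 'v \<Rightarrow> bool" where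
  "enumerable enc P c D v \<longleftrightarrow>
     (\<forall>addr M R. stores enc addr D M \<and> R 0 = addr v \<longrightarrow>
        enumerates_output_linear P c (start R M) (encode_string enc ` den D v) \<and>
        (\<forall>n. halted P (run P n (start R M)) \<longrightarrow> stores enc addr D (mem (run P n (start R M)))))"

end

theory Submission
  imports Defs
begin

text \<open>Writing a safe node as a shift by \<open>k\<close> over an output node \<open>u\<close>, the union with a shift by
  \<open>l\<close> over \<open>t\<close> is \<open>sh (u \<union> sh t (l - k)) k\<close>; if both arguments lie over unions \<open>o\<^sub>1 \<union> s\<^sub>1\<close> and
  \<open>o\<^sub>2 \<union> s\<^sub>2\<close>, the two output nodes are pulled in front of the remainders \<open>s\<^sub>1\<close> and \<open>s\<^sub>2\<close>. Thus
  every node keeps an output node within distance four along left children.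

  Enumeration is backtracking with shared stacks: a product expands its right factor first, so that
  the current word grows by consing to the left, and a union suspends its right alternative
  together with pointers to the remaining goals and the suffix built so far. Resuming an alternative
  therefore takes constant time whatever was output before, and completing a word takes time linear in
  its length because a derivation with \<open>n\<close> leaves has \<open>n - 1\<close> products and a bounded number of
  other nodes in between.\<close>

section \<open>Adding nodes and keeping them safe\<close>

text \<open>Output-depth is not stored, so the operations can branch only on labels, read off as
  tags; and correctness and persistence are claimed without safety. Hence \<open>impl\<close>
  answers every request, naively where the shape of the arguments does not help, and safety enters
  only when output-depth is bounded. Every node has to be enumerable, also the auxiliary ones, so
  the invariant \<open>tame\<close> bounds the output-depth of all of them. The bound four comes
  from \<open>interleave\<close>: a remainder of output-depth at most 2 gets a shift and then a
  union above it. That the descent pays off rests on two facts about words. No node denotes the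
  empty set, so following left alternatives never fails and every suspended alternative yields a new
  word. No word is empty, so fixed costs such as initialisation or resumption can be charged to its
  letters. The graph is unfolded into trees for this analysis; the machine itself works on the
  shared graph.\<close>

lemma extends_trans: "extends D D' \<Longrightarrow> extends D' D'' \<Longrightarrow> extends D D''"
  by (auto simp: extends_def)

lemma extends_nodes: "extends D D' \<Longrightarrow> u \<in> nodes D \<Longrightarrow> u \<in> nodes D'"
  by (auto simp: extends_def)

lemma extends_lab:
  "extends D D' \<Longrightarrow> u \<in> nodes D \<Longrightarrow> lab D' u = lab D u"
  "extends D D' \<Longrightarrow> u \<in> nodes D \<Longrightarrow> left D' u = left D u"
  "extends D D' \<Longrightarrow> u \<in> nodes D \<Longrightarrow> right D' u = right D u"
  by (auto simp: extends_def)

lemma output_node_lab: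
  "output_node D v \<longleftrightarrow> v \<in> nodes D \<and> (lab D v \<in> range LBottom \<or> lab D v = LProd)"
  by (auto simp: output_node_def bottom_node_def product_node_def)

lemma node_children:
  assumes "shift_ecs D" "v \<in> nodes D"
  shows "lab D v = LShift k \<Longrightarrow> \<exists>u. left D v = Some u \<and> u \<in> nodes D \<and> right D v = None"
    and "lab D v = LUnion \<Longrightarrow>
      \<exists>u w. left D v = Some u \<and> u \<in> nodes D \<and> right D v = Some w \<and> w \<in> nodes D"
    and "lab D v = LProd \<Longrightarrow>
      \<exists>u w. left D v = Some u \<and> u \<in> nodes D \<and> right D v = Some w \<and> w \<in> nodes D"
    and "lab D v = LBottom x \<Longrightarrow> x \<in> alphabet D"
proof -
  have v: "lab D v \<in> LBottom ` alphabet D \<union> range LShift \<union> {LUnion, LProd}"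
    "left D v \<noteq> None \<longleftrightarrow> lab D v \<in> range LShift \<union> {LUnion, LProd}"
    "right D v \<noteq> None \<longleftrightarrow> lab D v \<in> {LUnion, LProd}"
    using assms unfolding shift_ecs_def by blast+
  have "u \<in> nodes D" if "left D v = Some u \<or> right D v = Some u" for u
    using assms(1) that by (auto simp: shift_ecs_def children_def)
  with v show "lab D v = LShift k \<Longrightarrow> \<exists>u. left D v = Some u \<and> u \<in> nodes D \<and> right D v = None"
    and "lab D v = LUnion \<Longrightarrow>
      \<exists>u w. left D v = Some u \<and> u \<in> nodes D \<and> right D v = Some w \<and> w \<in> nodes D"
    and "lab D v = LProd \<Longrightarrow>
      \<exists>u w. left D v = Some u \<and> u \<in> nodes D \<and> right D v = Some w \<and> w \<in> nodes D"
    and "lab D v = LBottom x \<Longrightarrow> x \<in> alphabet D"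
    by auto
qed

text \<open>Persistence: the children of an old node are old, so induction along the old graph never
  meets a new node.\<close>

lemma extends_den:
  assumes "shift_ecs D" "shift_ecs D'" "extends D D'"
  shows "u \<in> nodes D \<Longrightarrow> den D' u = den D u"
proof (induction u rule: wf_induct_rule[OF shift_ecs_wf[OF assms(1)]])
  case (1 u)
  note IH = 1(1) and u = 1(2)
  have *: "den D' w = den D w" if "left D u = Some w \<or> right D u = Some w" "w \<in> nodes D" for w
    using IH that by (simp add: children_def)
  have "u \<in> nodes D'"
    using assms(3) u by (rule extends_nodes)
  then show ?case
    using node_children[OF assms(1) u] *
    unfolding den_simp[OF assms(1) u] den_simp[OF assms(2) \<open>u \<in> nodes D'\<close>]
    by (auto simp: extends_lab[OF assms(3) u] split: label.split)
qed

lemma extends_output_node: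
  "extends D D' \<Longrightarrow> u \<in> nodes D \<Longrightarrow> output_node D' u \<longleftrightarrow> output_node D u"
  by (auto simp: output_node_lab extends_def)

lemma extends_odepth:
  assumes "shift_ecs D" "shift_ecs D'" "extends D D'"
  shows "u \<in> nodes D \<Longrightarrow> odepth D' u = odepth D u"
proof (induction u rule: wf_induct_rule[OF shift_ecs_wf[OF assms(1)]])
  case (1 u)
  note IH = 1(1) and u = 1(2)
  have "u \<in> nodes D'"
    using assms(3) u by (rule extends_nodes)
  moreover have "odepth D' (lchild D u) = odepth D (lchild D u)" if "\<not> output_node D u"
    using that IH shift_ecs_left[OF assms(1) u] by (simp add: output_node_def)
  ultimately show ?case
    unfolding odepth_simp[OF assms(1) u] odepth_simp[OF assms(2) \<open>u \<in> nodes D'\<close>]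
    by (simp add: extends_lab[OF assms(3) u] extends_output_node[OF assms(3) u])
qed

section \<open>Extending a structure by one node\<close>

definition new :: "('o, nat) ecs \<Rightarrow> nat" where
  "new D = (LEAST n. n \<notin> nodes D)"

lemma new_notin: "shift_ecs D \<Longrightarrow> new D \<notin> nodes D"
  unfolding new_def by (rule LeastI_ex) (auto simp: shift_ecs_def intro: ex_new_if_finite)

fun node_label :: "('o, 'v) request \<Rightarrow> 'o label" where
  "node_label (Add x) = LBottom x"
| "node_label (Prod v w) = LProd"
| "node_label (Union v w) = LUnion"
| "node_label (Shift v k) = LShift k"

fun node_left :: "('o, 'v) request \<Rightarrow> 'v option" where
  "node_left (Add x) = None"
| "node_left (Prod v w) = Some v"
| "node_left (Union v w) = Some v"
| "node_left (Shift v k) = Some v"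

fun node_right :: "('o, 'v) request \<Rightarrow> 'v option" where
  "node_right (Add x) = None"
| "node_right (Prod v w) = Some w"
| "node_right (Union v w) = Some w"
| "node_right (Shift v k) = None"

text \<open>Requests double as descriptions of single nodes: \<open>ext D q\<close> answers \<open>q\<close> naively, by one node.\<close>

definition ext :: "('o, nat) ecs \<Rightarrow> ('o, nat) request \<Rightarrow> ('o, nat) ecs" where
  "ext D q = D\<lparr>nodes := insert (new D) (nodes D), left := (left D)(new D := node_left q),
     right := (right D)(new D := node_right q), lab := (lab D)(new D := node_label q)\<rparr>"

fun well_formed :: "('o, 'v) ecs \<Rightarrow> ('o, 'v) request \<Rightarrow> bool" where
  "well_formed D (Add x) \<longleftrightarrow> x \<in> alphabet D"
| "well_formed D (Prod v w) \<longleftrightarrow> v \<in> nodes D \<and> w \<in> nodes D"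
| "well_formed D (Union v w) \<longleftrightarrow> v \<in> nodes D \<and> w \<in> nodes D"
| "well_formed D (Shift v k) \<longleftrightarrow> v \<in> nodes D"

lemma admissible_well_formed: "admissible D q \<Longrightarrow> well_formed D q"
  by (cases q) auto

lemma ext_new [simp]:
  "nodes (ext D q) = insert (new D) (nodes D)"
  "alphabet (ext D q) = alphabet D"
  "lab (ext D q) (new D) = node_label q"
  "left (ext D q) (new D) = node_left q"
  "right (ext D q) (new D) = node_right q"
  by (simp_all add: ext_def)

lemma extends_ext: "shift_ecs D \<Longrightarrow> extends D (ext D q)"
  using new_notin[of D] by (auto simp: extends_def ext_def)

text \<open>A cycle through the new edge would have to return to its source \<open>y\<close>, which
  no edge of \<open>r\<close> enters.\<close>

lemma acyclic_insert_source:
  assumes "acyclic r" "y \<notin> Range r" "x \<noteq> y"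
  shows "acyclic (insert (y, x) r)"
  using assms by (auto elim: rtranclE)

lemma shift_ecs_ext:
  assumes D: "shift_ecs D" and q: "well_formed D q"
  shows "shift_ecs (ext D q)"
proof -
  let ?y = "new D"
  have y: "?y \<notin> nodes D"
    using D by (rule new_notin)
  have sub: "children D \<subseteq> nodes D \<times> nodes D" and ac: "acyclic (children D)"
    using D by (auto simp: shift_ecs_def)
  \<comment> \<open>\<open>left\<close> and \<open>right\<close> are functions on all names, so it
    must be ruled out that the fresh name already carries edges: \<open>children D\<close> lies
    within the nodes.\<close>
  have "\<not> (left D ?y = Some u \<or> right D ?y = Some u)" for u
    using sub y by (auto simp: children_def)
  then have none: "left D ?y = None" "right D ?y = None"
    by (meson option.exhaust)+
  have ch: "children (ext D q) = children D \<union> {?y} \<times> arg_nodes q"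
    using none by (cases q) (auto simp: children_def ext_def split: if_splits)
  have "arg_nodes q \<subseteq> nodes D"
    using q by (cases q) auto
  then have sub': "children (ext D q) \<subseteq> nodes (ext D q) \<times> nodes (ext D q)"
    using sub unfolding ch by auto
  have r: "?y \<notin> Range (children D)"
    using sub y by auto
  have edge: "acyclic (insert (?y, u) (children D))" if "u \<in> nodes D" for u
    by (rule acyclic_insert_source[OF ac r]) (use that y in auto)
  have edges: "acyclic (insert (?y, w) (insert (?y, u) (children D)))"
    if "u \<in> nodes D" "w \<in> nodes D" for u w
    by (rule acyclic_insert_source[OF edge]) (use that y r in auto)
  have "acyclic (children (ext D q))"
    using q edge edges ac unfolding ch by (cases q) (auto simp: insert_commute)
  moreover have "\<forall>v\<in>nodes D. lab (ext D q) v = lab D v \<and> left (ext D q) v = left D v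
      \<and> right (ext D q) v = right D v"
    using extends_ext[OF D, of q] by (simp add: extends_def)
  ultimately show ?thesis
    using D q sub' unfolding shift_ecs_def by (cases q) auto
qed

lemma den_ext_old:
  assumes "shift_ecs D" "well_formed D q" "u \<in> nodes D"
  shows "den (ext D q) u = den D u"
  using extends_den[OF assms(1) shift_ecs_ext[OF assms(1,2)] extends_ext[OF assms(1)] assms(3)] .

lemma odepth_ext_old:
  assumes "shift_ecs D" "well_formed D q" "u \<in> nodes D"
  shows "odepth (ext D q) u = odepth D u"
  using extends_odepth[OF assms(1) shift_ecs_ext[OF assms(1,2)] extends_ext[OF assms(1)] assms(3)] .

lemma den_ext_new:
  assumes "shift_ecs D" "well_formed D q"
  shows "den (ext D q) (new D) = result_set D q"
  using den_simp[OF shift_ecs_ext[OF assms], of "new D"] assms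
  by (cases q) (auto simp: den_ext_old)

fun request_odepth :: "('o, 'v) ecs \<Rightarrow> ('o, 'v) request \<Rightarrow> nat" where
  "request_odepth D (Add x) = 0"
| "request_odepth D (Prod v w) = 0"
| "request_odepth D (Union v w) = Suc (odepth D v)"
| "request_odepth D (Shift v k) = Suc (odepth D v)"

lemma odepth_ext_new:
  assumes "shift_ecs D" "well_formed D q"
  shows "odepth (ext D q) (new D) = request_odepth D q"
  using odepth_simp[OF shift_ecs_ext[OF assms], of "new D"] assms
  by (cases q) (auto simp: odepth_ext_old output_node_lab)

text \<open>What makes backtracking output-linear: every node reaches its first output node after at
  most four steps, and no word has two derivations.\<close>

definition tame :: "('o, 'v) ecs \<Rightarrow> bool" where
  "tame D \<longleftrightarrow> shift_ecs D \<and> (\<forall>v\<in>nodes D. odepth D v \<le> 4 \<and>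
     (lab D v = LUnion \<longrightarrow> den D (lchild D v) \<inter> den D (rchild D v) = {}) \<and>
     (lab D v = LProd \<longrightarrow> unambiguous (den D (lchild D v)) (den D (rchild D v))))"

lemma tame_shift_ecs: "tame D \<Longrightarrow> shift_ecs D"
  by (simp add: tame_def)

lemma tame_ext:
  assumes "tame D" "admissible D q" "request_odepth D q \<le> 4"
  shows "tame (ext D q)"
proof -
  have D: "shift_ecs D" and q: "well_formed D q"
    using assms by (auto simp: tame_def admissible_well_formed)
  have "lchild D v \<in> nodes D \<and> rchild D v \<in> nodes D"
    if "v \<in> nodes D" "lab D v = LUnion \<or> lab D v = LProd" for v
    using node_children[OF D that(1)] that(2) by auto
  then have "odepth (ext D q) v \<le> 4 \<and>
      (lab (ext D q) v = LUnion \<longrightarrow>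
        den (ext D q) (lchild (ext D q) v) \<inter> den (ext D q) (rchild (ext D q) v) = {}) \<and>
      (lab (ext D q) v = LProd \<longrightarrow>
        unambiguous (den (ext D q) (lchild (ext D q) v)) (den (ext D q) (rchild (ext D q) v)))"
    if "v \<in> nodes D" for v
    using that assms(1) extends_lab[OF extends_ext[OF D] that]
    by (simp add: tame_def den_ext_old[OF D q] odepth_ext_old[OF D q])
  moreover have "odepth (ext D q) (new D) \<le> 4"
    using assms(3) by (simp add: odepth_ext_new[OF D q])
  moreover have "(lab (ext D q) (new D) = LUnion \<longrightarrow>
        den (ext D q) (lchild (ext D q) (new D)) \<inter> den (ext D q) (rchild (ext D q) (new D)) = {}) \<and>
      (lab (ext D q) (new D) = LProd \<longrightarrow>
        unambiguous (den (ext D q) (lchild (ext D q) (new D)))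
          (den (ext D q) (rchild (ext D q) (new D))))"
    using assms(2) by (cases q) (simp_all add: den_ext_old[OF D])
  ultimately show ?thesis
    using shift_ecs_ext[OF D q] unfolding tame_def by simp
qed

section \<open>Shifts of languages\<close>

lemma sh_sh: "sh (sh A k) l = sh A (k + l)"
  by (simp add: sh_def image_image split_def comp_def add.assoc)

lemma sh_0 [simp]: "sh A 0 = A"
  by (simp add: sh_def)

lemma sh_Un: "sh (A \<union> B) k = sh A k \<union> sh B k"
  by (simp add: sh_def image_Un)

lemma sh_Int: "sh (A \<inter> B) k = sh A k \<inter> sh B k"
proof -
  have "inj (map (\<lambda>(x, i). (x, i + k)) :: ('a \<times> int) list \<Rightarrow> _)"
    by (rule inj_mapI) (auto simp: inj_on_def)
  then show ?thesis
    by (simp add: sh_def image_Int)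
qed

lemma sh_empty_iff [simp]: "sh A k = {} \<longleftrightarrow> A = {}"
  by (simp add: sh_def)

text \<open>Shifting by \<open>k\<close> is injective and so commutes with intersection; taking
  \<open>k\<close> out of both sides leaves \<open>l - k\<close> on the second.\<close>

lemma sh_disjoint_iff: "sh A k \<inter> sh B l = {} \<longleftrightarrow> A \<inter> sh B (l - k) = {}"
proof -
  have "sh A k \<inter> sh B l = sh (A \<inter> sh B (l - k)) k"
    by (simp add: sh_Int sh_sh)
  then show ?thesis
    by simp
qed

text \<open>Changes the frame of reference from one argument of a union to the other: both
  conditions say that \<open>sh A k\<close> and \<open>sh B l\<close> are disjoint.\<close>

lemma sh_disjoint_swap:
  assumes "A \<inter> sh B (l - k) = {}"
  shows "B \<inter> sh A (k - l) = {}"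
proof -
  have "sh A k \<inter> sh B l = {}"
    unfolding sh_disjoint_iff by (rule assms)
  then have "sh B l \<inter> sh A k = {}"
    by blast
  then show ?thesis
    by (simp only: sh_disjoint_iff)
qed

section \<open>The operations as extensions by several nodes\<close>

definition graft :: "('o, nat) ecs \<Rightarrow> nat \<Rightarrow> int \<Rightarrow> nat \<Rightarrow> int \<Rightarrow> ('o, nat) ecs \<times> nat" where
  "graft D u k t l = (let D1 = ext D (Shift t (l - k)); D2 = ext D1 (Union u (new D))
     in (ext D2 (Shift (new D1) k), new D2))"

text \<open>With u = u1 \<union> u2 and t = t1 \<union> t2 the result denotes \<open>sh (u1 \<union>
  sh (t1 \<union> (sh u2 (k - l) \<union> t2)) (l - k)) k\<close>: u2 is moved into the frame of t,
  and grafting moves the whole into that of u. As in \<open>graft\<close>, \<open>new D\<close>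
  names the node that \<open>ext D\<close> adds.\<close>

definition interleave :: "('o, nat) ecs \<Rightarrow> nat \<Rightarrow> int \<Rightarrow> nat \<Rightarrow> int \<Rightarrow> ('o, nat) ecs \<times> nat" where
  "interleave D u k t l =
     (let D1 = ext D (Shift (rchild D u) (k - l));
          D2 = ext D1 (Union (new D) (rchild D t));
          D3 = ext D2 (Union (lchild D t) (new D1))
      in graft D3 (lchild D u) k (new D2) l)"

text \<open>A safe node is a shift node, whence the shift by 0 above new output nodes. A shift
  applied to a shift node is merged with it instead of stacked, so output-depth does not grow. The
  conditions test labels only, which a program can do in constant time; the remaining cases keep the
  operations correct on arbitrary nodes.\<close>

fun impl :: "('o, nat) ecs \<Rightarrow> ('o, nat) request \<Rightarrow> ('o, nat) ecs \<times> nat" where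
  "impl D (Add x) = (let D1 = ext D (Add x) in (ext D1 (Shift (new D) 0), new D1))"
| "impl D (Prod v w) = (let D1 = ext D (Prod v w) in (ext D1 (Shift (new D) 0), new D1))"
| "impl D (Shift v k) = (case lab D v of
      LShift j \<Rightarrow> (ext D (Shift (lchild D v) (k + j)), new D)
    | _ \<Rightarrow> (ext D (Shift v k), new D))"
| "impl D (Union v w) = (case (lab D v, lab D w) of
      (LShift k, LShift l) \<Rightarrow>
        (let u = lchild D v; t = lchild D w in
         if output_node D u then graft D u k t l
         else if output_node D t then graft D t l u k
         else if lab D u = LUnion \<and> lab D t = LUnion then interleave D u k t l
         else (ext D (Union v w), new D))
    | _ \<Rightarrow> (ext D (Union v w), new D))"

definition implements :: "('o, 'v) ecs \<Rightarrow> ('o, 'v) ecs \<Rightarrow> 'v \<Rightarrow> ('o \<times> int) list set \<Rightarrow> bool" where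
  "implements D D' v A \<longleftrightarrow> shift_ecs D' \<and> extends D D' \<and> v \<in> nodes D' - nodes D \<and> den D' v = A"

lemma implements_ext:
  assumes "shift_ecs D" "well_formed D q"
  shows "implements D (ext D q) (new D) (result_set D q)"
  using assms by (simp add: implements_def shift_ecs_ext extends_ext den_ext_new new_notin)

lemma implements_extends:
  "extends D D' \<Longrightarrow> implements D' D'' v A \<Longrightarrow> implements D D'' v A"
  by (auto simp: implements_def dest: extends_trans extends_nodes)

lemma implements_graft:
  assumes D: "shift_ecs D" and "u \<in> nodes D" "t \<in> nodes D" and g: "graft D u k t l = (D', v')"
  shows "implements D D' v' (sh (den D u) k \<union> sh (den D t) l)"
proof -
  define D1 where "D1 = ext D (Shift t (l - k))"
  define D2 where "D2 = ext D1 (Union u (new D))"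
  have q1: "well_formed D (Shift t (l - k))"
    using assms by simp
  have D1: "shift_ecs D1"
    using D q1 unfolding D1_def by (rule shift_ecs_ext)
  have q2: "well_formed D1 (Union u (new D))"
    using assms by (simp add: D1_def)
  have D2: "shift_ecs D2"
    using D1 q2 unfolding D2_def by (rule shift_ecs_ext)
  have "den D2 (new D1) = den D u \<union> sh (den D t) (l - k)"
    using den_ext_new[OF D1 q2] den_ext_new[OF D q1] den_ext_old[OF D q1] assms(2)
    by (simp add: D1_def D2_def)
  then have "implements D2 (ext D2 (Shift (new D1) k)) (new D2) (sh (den D u) k \<union> sh (den D t) l)"
    using implements_ext[OF D2, of "Shift (new D1) k"] by (simp add: D2_def sh_Un sh_sh)
  moreover have "extends D D2"
    using extends_trans[OF extends_ext[OF D] extends_ext] D1 unfolding D1_def D2_def by blast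
  moreover have "D' = ext D2 (Shift (new D1) k)" "v' = new D2"
    using g by (auto simp: graft_def Let_def D1_def D2_def)
  ultimately show ?thesis
    by (metis implements_extends)
qed

text \<open>The new union has the output node \<open>u\<close> on its left, hence output-depth 1,
  and a shift of output-depth at most 2 on its right: exactly the second form of
  \<open>safe\<close>. Disjointness is stated in the frame of \<open>u\<close>, where the union is
  taken.\<close>

lemma graft_safe:
  assumes D: "tame D" and u: "u \<in> nodes D" and t: "t \<in> nodes D" and g: "graft D u k t l = (D', v')"
    and out: "output_node D u" and depth: "odepth D t \<le> 1"
    and disj: "den D u \<inter> sh (den D t) (l - k) = {}"
  shows "tame D' \<and> safe D' v'"
proof -
  define D1 where "D1 = ext D (Shift t (l - k))"
  define D2 where "D2 = ext D1 (Union u (new D))"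
  define D3 where "D3 = ext D2 (Shift (new D1) k)"
  note sD = tame_shift_ecs[OF D]
  have u0: "odepth D u = 0"
    using odepth_simp[OF sD u] out by simp
  have q1: "well_formed D (Shift t (l - k))"
    using t by simp
  have D1: "tame D1"
    unfolding D1_def by (rule tame_ext[OF D]) (use t depth in auto)
  note sD1 = tame_shift_ecs[OF D1]
  have d1: "den D1 u = den D u" "den D1 (new D) = sh (den D t) (l - k)"
      "odepth D1 u = 0" "odepth D1 (new D) \<le> 2"
    using den_ext_new[OF sD q1] den_ext_old[OF sD q1] odepth_ext_old[OF sD q1]
      odepth_ext_new[OF sD q1] u depth u0 by (auto simp: D1_def)
  have n1: "u \<in> nodes D1" "new D \<in> nodes D1"
    using u by (auto simp: D1_def)
  have q2: "well_formed D1 (Union u (new D))"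
    using n1 by simp
  have D2: "tame D2"
    unfolding D2_def by (rule tame_ext[OF D1]) (use n1 d1 disj in auto)
  note sD2 = tame_shift_ecs[OF D2]
  have d2: "odepth D2 (new D1) = 1" "odepth D2 (new D) \<le> 2"
    using odepth_ext_old[OF sD1 q2] odepth_ext_new[OF sD1 q2] d1 n1 by (auto simp: D2_def)
  have n2: "new D1 \<in> nodes D2" "new D \<in> nodes D2"
    using n1 by (auto simp: D2_def)
  have q3: "well_formed D2 (Shift (new D1) k)"
    using n2 by simp
  have D3: "tame D3"
    unfolding D3_def by (rule tame_ext[OF D2]) (use n2 d2 in auto)
  have d3: "odepth D3 (new D1) = 1" "odepth D3 (new D) \<le> 2"
    using odepth_ext_old[OF sD2 q3] d2 n2 by (auto simp: D3_def)
  have e12: "extends D1 D2" and e23: "extends D2 D3"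
    using extends_ext sD1 sD2 unfolding D2_def D3_def by auto
  have "lab D3 (new D1) = LUnion" "right D3 (new D1) = Some (new D)"
    using extends_lab[OF e23 n2(1)] by (simp_all add: D2_def)
  moreover have "lab D3 (new D) = LShift (l - k)"
    using extends_lab[OF e23 n2(2)] extends_lab[OF e12 n1(2)] by (simp add: D1_def)
  moreover have "lab D3 (new D2) = LShift k" "left D3 (new D2) = Some (new D1)"
      "new D2 \<in> nodes D3" "new D1 \<in> nodes D3" "new D \<in> nodes D3"
    using n2 by (simp_all add: D3_def)
  ultimately have "safe D3 (new D2)"
    using d3 by (simp add: safe_def Let_def shift_node_def union_node_def)
  moreover have "D' = D3" "v' = new D2"
    using g by (auto simp: graft_def Let_def D1_def D2_def D3_def)
  ultimately show ?thesis
    using D3 by simp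
qed

text \<open>The three nodes below the final graft, shared by the proofs of correctness, safety and
  memory layout. Only the last conclusion supposes bounded output-depth and disjointness.\<close>

lemma interleave_prefix:
  assumes D: "shift_ecs D" and u: "u \<in> nodes D" "lab D u = LUnion"
    and t: "t \<in> nodes D" "lab D t = LUnion"
    and D1_def: "D1 = ext D (Shift (rchild D u) (k - l))"
    and D2_def: "D2 = ext D1 (Union (new D) (rchild D t))"
    and D3_def: "D3 = ext D2 (Union (lchild D t) (new D1))"
  shows "shift_ecs D3" "extends D D3" "lchild D u \<in> nodes D3" "new D2 \<in> nodes D3"
    "den D3 (new D2) = den D t \<union> sh (den D (rchild D u)) (k - l)"
    "odepth D3 (new D2) = Suc (odepth D (lchild D t))"
    "tame D \<Longrightarrow> den D (rchild D t) \<inter> sh (den D (rchild D u)) (k - l) = {} \<Longrightarrow>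
     den D (lchild D t) \<inter> sh (den D (rchild D u)) (k - l) = {} \<Longrightarrow>
     odepth D (rchild D u) \<le> 2 \<Longrightarrow> odepth D (lchild D t) = 0 \<Longrightarrow> tame D3"
proof -
  obtain a b where ab: "left D u = Some a" "right D u = Some b" "a \<in> nodes D" "b \<in> nodes D"
    using node_children(2)[OF D u] by blast
  obtain a' b' where ab': "left D t = Some a'" "right D t = Some b'" "a' \<in> nodes D" "b' \<in> nodes D"
    using node_children(2)[OF D t] by blast
  have q1: "well_formed D (Shift (rchild D u) (k - l))"
    using ab by simp
  have D1: "shift_ecs D1"
    using D q1 unfolding D1_def by (rule shift_ecs_ext)
  have n1: "new D \<in> nodes D1" "b' \<in> nodes D1" "a' \<in> nodes D1"
    using ab' by (auto simp: D1_def)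
  have q2: "well_formed D1 (Union (new D) (rchild D t))"
    using n1 ab' by simp
  have D2: "shift_ecs D2"
    using D1 q2 unfolding D2_def by (rule shift_ecs_ext)
  have n2: "new D1 \<in> nodes D2" "a' \<in> nodes D2"
    using n1 by (auto simp: D2_def)
  have q3: "well_formed D2 (Union (lchild D t) (new D1))"
    using n2 ab' by simp
  show D3: "shift_ecs D3"
    using D2 q3 unfolding D3_def by (rule shift_ecs_ext)
  show "extends D D3"
    using extends_trans[OF extends_trans[OF extends_ext[OF D] extends_ext] extends_ext] D1 D2
    unfolding D1_def D2_def D3_def by blast
  then show "lchild D u \<in> nodes D3"
    using ab extends_nodes by fastforce
  show "new D2 \<in> nodes D3"
    by (simp add: D3_def)
  have d1: "den D1 (new D) = sh (den D b) (k - l)" "den D1 b' = den D b'" "den D1 a' = den D a'"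
      "odepth D1 (new D) = Suc (odepth D b)" "odepth D1 a' = odepth D a'"
    using den_ext_new[OF D q1] den_ext_old[OF D q1] odepth_ext_new[OF D q1] odepth_ext_old[OF D q1]
      ab ab' by (auto simp: D1_def)
  have d2: "den D2 (new D1) = sh (den D b) (k - l) \<union> den D b'" "den D2 a' = den D a'"
      "odepth D2 a' = odepth D a'"
    using den_ext_new[OF D1 q2] den_ext_old[OF D1 q2] odepth_ext_old[OF D1 q2] n1 d1 ab'
    by (auto simp: D2_def)
  have "den D t = den D a' \<union> den D b'"
    using den_simp[OF D t(1)] t(2) ab' by simp
  then show "den D3 (new D2) = den D t \<union> sh (den D (rchild D u)) (k - l)"
    using den_ext_new[OF D2 q3] d2 ab ab' by (auto simp: D3_def)
  show "odepth D3 (new D2) = Suc (odepth D (lchild D t))"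
    using odepth_ext_new[OF D2 q3] d2 ab' by (auto simp: D3_def)
  assume tame: "tame D" and disj: "den D (rchild D t) \<inter> sh (den D (rchild D u)) (k - l) = {}"
    "den D (lchild D t) \<inter> sh (den D (rchild D u)) (k - l) = {}"
    and depth: "odepth D (rchild D u) \<le> 2" "odepth D (lchild D t) = 0"
  have "den D (lchild D t) \<inter> den D (rchild D t) = {}"
    using tame t by (simp add: tame_def)
  then have "den D a' \<inter> den D b' = {}"
    using ab' by simp
  have T1: "tame D1"
    unfolding D1_def by (rule tame_ext[OF tame]) (use ab depth in auto)
  \<comment> \<open>The left child is a shift over \<open>rchild D u\<close>, of output-depth up to
    3, so this union may attain the four allowed by \<open>tame\<close>.\<close>
  have T2: "tame D2"
    unfolding D2_def by (rule tame_ext[OF T1]) (use n1 d1 ab ab' disj depth in auto)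
  show "tame D3"
    unfolding D3_def
    by (rule tame_ext[OF T2]) (use n2 d2 ab ab' disj depth \<open>den D a' \<inter> den D b' = {}\<close> in auto)
qed

lemma implements_interleave:
  assumes D: "shift_ecs D" and u: "u \<in> nodes D" "lab D u = LUnion"
    and t: "t \<in> nodes D" "lab D t = LUnion" and g: "interleave D u k t l = (D', v')"
  shows "implements D D' v' (sh (den D u) k \<union> sh (den D t) l)"
proof -
  define D1 where "D1 = ext D (Shift (rchild D u) (k - l))"
  define D2 where "D2 = ext D1 (Union (new D) (rchild D t))"
  define D3 where "D3 = ext D2 (Union (lchild D t) (new D1))"
  note p = interleave_prefix[OF D u t D1_def D2_def D3_def]
  have "graft D3 (lchild D u) k (new D2) l = (D', v')"
    using g by (simp add: interleave_def Let_def D1_def D2_def D3_def)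
  from implements_graft[OF p(1,3,4) this]
  have "implements D D' v' (sh (den D3 (lchild D u)) k \<union> sh (den D3 (new D2)) l)"
    by (rule implements_extends[OF p(2)])
  moreover have "den D3 (lchild D u) = den D (lchild D u)"
    using extends_den[OF D p(1,2)] node_children(2)[OF D u] by auto
  moreover have "den D u = den D (lchild D u) \<union> den D (rchild D u)"
    using den_simp[OF D u(1)] u(2) by simp
  ultimately show ?thesis
    by (simp add: p(5) sh_Un sh_sh Un_ac)
qed

lemma interleave_safe:
  assumes D: "tame D" and u: "u \<in> nodes D" "lab D u = LUnion"
    and t: "t \<in> nodes D" "lab D t = LUnion" and g: "interleave D u k t l = (D', v')"
    and depth: "odepth D u = 1" "odepth D (rchild D u) \<le> 2" "odepth D t = 1"
    and disj: "den D u \<inter> sh (den D t) (l - k) = {}"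
  shows "tame D' \<and> safe D' v'"
proof -
  define D1 where "D1 = ext D (Shift (rchild D u) (k - l))"
  define D2 where "D2 = ext D1 (Union (new D) (rchild D t))"
  define D3 where "D3 = ext D2 (Union (lchild D t) (new D1))"
  note sD = tame_shift_ecs[OF D]
  note p = interleave_prefix[OF sD u t D1_def D2_def D3_def]
  have lu: "lchild D u \<in> nodes D"
    using node_children(2)[OF sD u] by auto
  have den_u: "den D u = den D (lchild D u) \<union> den D (rchild D u)"
    and den_t: "den D t = den D (lchild D t) \<union> den D (rchild D t)"
    using den_simp[OF sD] u t by simp_all
  have "den D (lchild D u) \<inter> den D (rchild D u) = {}"
    using D u by (simp add: tame_def)
  \<comment> \<open>Disjointness in the frame of \<open>t\<close>, where the remainder of
    \<open>u\<close> is joined to the parts of \<open>t\<close>.\<close>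
  have *: "den D t \<inter> sh (den D u) (k - l) = {}"
    using disj by (rule sh_disjoint_swap)
  have no: "\<not> output_node D u" "\<not> output_node D t"
    using u t by (auto simp: output_node_lab)
  have l0: "odepth D (lchild D u) = 0" "odepth D (lchild D t) = 0"
    using odepth_simp[OF sD u(1)] odepth_simp[OF sD t(1)] depth(1,3) no by simp_all
  have "output_node D (lchild D u)"
    using odepth_simp[OF sD lu] l0 by (auto split: if_splits)
  then have out: "output_node D3 (lchild D u)"
    using extends_output_node[OF p(2) lu] by simp
  have T3: "tame D3"
    by (rule p(7)[OF D]) (use * depth l0 in \<open>auto simp: den_u den_t sh_Un\<close>)
  have d3: "odepth D3 (new D2) \<le> 1"
    using p(6) l0 by simp
  \<comment> \<open>The shifts by \<open>k - l\<close> and \<open>l - k\<close> cancel on the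
    remainder of \<open>u\<close>, which is disjoint from \<open>lchild D u\<close> by
    \<open>tame\<close>; the rest is the assumption on \<open>t\<close>.\<close>
  have disj3: "den D3 (lchild D u) \<inter> sh (den D3 (new D2)) (l - k) = {}"
    using disj \<open>den D (lchild D u) \<inter> den D (rchild D u) = {}\<close>
    unfolding extends_den[OF sD p(1,2) lu] p(5) by (auto simp: sh_Un sh_sh den_u)
  have "graft D3 (lchild D u) k (new D2) l = (D', v')"
    using g by (simp add: interleave_def Let_def D1_def D2_def D3_def)
  then show ?thesis
    using graft_safe[OF T3 p(3,4) _ out d3 disj3] by blast
qed

lemma implements_wrap:
  assumes D: "shift_ecs D" and q: "well_formed D q"
  shows "implements D (ext (ext D q) (Shift (new D) 0)) (new (ext D q)) (result_set D q)"
proof -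
  have "shift_ecs (ext D q)"
    using D q by (rule shift_ecs_ext)
  from implements_ext[OF this, of "Shift (new D) 0"] show ?thesis
    using implements_extends[OF extends_ext[OF D]] den_ext_new[OF D q] by simp
qed

lemma wrap_safe:
  assumes D: "tame D" and q: "admissible D q" "request_odepth D q = 0"
  shows "tame (ext (ext D q) (Shift (new D) 0)) \<and>
    safe (ext (ext D q) (Shift (new D) 0)) (new (ext D q))"
proof -
  note sD = tame_shift_ecs[OF D] and wf = admissible_well_formed[OF q(1)]
  have T: "tame (ext D q)"
    using tame_ext[OF D] q by simp
  have o: "odepth (ext D q) (new D) = 0"
    using odepth_ext_new[OF sD wf] q by simp
  then have "output_node (ext D q) (new D)"
    using odepth_simp[OF tame_shift_ecs[OF T], of "new D"] by (auto split: if_splits)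
  then have "output_node (ext (ext D q) (Shift (new D) 0)) (new D)"
    using extends_output_node[OF extends_ext[OF tame_shift_ecs[OF T]]] by simp
  moreover have "tame (ext (ext D q) (Shift (new D) 0))"
    by (rule tame_ext[OF T]) (use o in auto)
  ultimately show ?thesis
    by (simp add: safe_def shift_node_def)
qed

lemma den_shift:
  assumes "shift_ecs D" "v \<in> nodes D" "lab D v = LShift j"
  shows "den D v = sh (den D (lchild D v)) j"
  using den_simp[OF assms(1,2)] assms(3) by simp

lemma implements_impl:
  assumes D: "shift_ecs D" and q: "well_formed D q" and i: "impl D q = (D', v')"
  shows "implements D D' v' (result_set D q)"
proof (cases q)
  case (Add x)
  then show ?thesis
    using implements_wrap[OF D q] i by (simp add: Let_def)
next
  case (Prod v w)
  then show ?thesis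
    using implements_wrap[OF D q] i by (simp add: Let_def)
next
  case (Shift v k)
  show ?thesis
  proof (cases "\<exists>j. lab D v = LShift j")
    case True
    then obtain j where j: "lab D v = LShift j" ..
    have v: "v \<in> nodes D"
      using q Shift by simp
    have "lchild D v \<in> nodes D"
      using node_children(1)[OF D v j] by auto
    then show ?thesis
      using implements_ext[OF D, of "Shift (lchild D v) (k + j)"] i Shift j
      by (simp add: den_shift[OF D v j] sh_sh add.commute)
  next
    case False
    then show ?thesis
      using implements_ext[OF D q] i Shift by (auto split: label.splits)
  qed
next
  case (Union v w)
  show ?thesis
  proof (cases "\<exists>k l. lab D v = LShift k \<and> lab D w = LShift l")
    case True
    then obtain k l where k: "lab D v = LShift k" and l: "lab D w = LShift l"
      by blast
    have v: "v \<in> nodes D" "w \<in> nodes D"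
      using q Union by simp_all
    have c: "lchild D v \<in> nodes D" "lchild D w \<in> nodes D"
      using node_children(1)[OF D v(1) k] node_children(1)[OF D v(2) l] by auto
    have r: "result_set D q = sh (den D (lchild D v)) k \<union> sh (den D (lchild D w)) l"
      using Union den_shift[OF D v(1) k] den_shift[OF D v(2) l] by simp
    let ?u = "lchild D v" and ?t = "lchild D w"
    have "impl D q = (if output_node D ?u then graft D ?u k ?t l
        else if output_node D ?t then graft D ?t l ?u k
        else if lab D ?u = LUnion \<and> lab D ?t = LUnion then interleave D ?u k ?t l
        else (ext D q, new D))"
      by (simp add: Union k l Let_def)
    note i = trans[OF this[symmetric] i]
    consider "D' = ext D q" "v' = new D" | "graft D ?u k ?t l = (D', v')"
      | "graft D ?t l ?u k = (D', v')"
      | "lab D ?u = LUnion" "lab D ?t = LUnion" "interleave D ?u k ?t l = (D', v')"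
      using i by (metis prod.inject)
    then show ?thesis
    proof cases
      case 1
      then show ?thesis
        using implements_ext[OF D q] by simp
    next
      case 2
      then show ?thesis
        unfolding r by (rule implements_graft[OF D c])
    next
      case 3
      then show ?thesis
        unfolding r Un_commute[of "sh _ k"] by (rule implements_graft[OF D c(2,1)])
    next
      case 4
      then show ?thesis
        unfolding r by (rule implements_interleave[OF D c(1) _ c(2)])
    qed
  next
    case False
    then show ?thesis
      using implements_ext[OF D q] i Union by (auto split: label.splits)
  qed
qed

text \<open>In both forms of safety \<open>odepth D u \<le> 1\<close>, the bound that
  \<open>graft_safe\<close> asks of its second argument; an output node on either side thus suffices
  for grafting.\<close>

lemma safe_cases:
  assumes D: "shift_ecs D" and v: "safe D v"
  obtains k u where "v \<in> nodes D" "lab D v = LShift k" "left D v = Some u" "u \<in> nodes D"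
    "odepth D u \<le> 1"
    "output_node D u \<or> lab D u = LUnion \<and> odepth D u = 1 \<and> odepth D (rchild D u) \<le> 2"
proof -
  from v obtain k where k: "v \<in> nodes D" "lab D v = LShift k"
    by (auto simp: safe_def shift_node_def)
  then obtain u where u: "left D v = Some u" "u \<in> nodes D"
    using node_children(1)[OF D] by blast
  have "odepth D u = 0" if "output_node D u"
    using that odepth_simp[OF D u(2)] by simp
  then show ?thesis
    using that[OF k u] v u by (auto simp: safe_def Let_def union_node_def)
qed

lemma impl_safe:
  assumes D: "tame D" and q: "admissible D q" and safe: "\<forall>v\<in>arg_nodes q. safe D v"
    and i: "impl D q = (D', v')"
  shows "tame D' \<and> safe D' v'"
proof (cases q)
  case (Add x)
  then show ?thesis
    using wrap_safe[OF D q] i by (simp add: Let_def)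
next
  case (Prod v w)
  then show ?thesis
    using wrap_safe[OF D q] i by (simp add: Let_def)
next
  case (Shift v k)
  note sD = tame_shift_ecs[OF D]
  have "safe D v"
    using safe Shift by simp
  then obtain j u where v: "v \<in> nodes D" "lab D v = LShift j" "left D v = Some u" "u \<in> nodes D"
    "odepth D u \<le> 1"
    "output_node D u \<or> lab D u = LUnion \<and> odepth D u = 1 \<and> odepth D (rchild D u) \<le> 2"
    by (rule safe_cases[OF sD])
  \<comment> \<open>Safety depends on what lies below the shift and not on its amount, so the new
    shift goes directly over \<open>u\<close>.\<close>
  let ?q = "Shift u (k + j)"
  have wf: "well_formed D ?q"
    using v by simp
  have e: "extends D (ext D ?q)"
    using sD by (rule extends_ext)
  have "tame (ext D ?q)"
    using tame_ext[OF D, of ?q] v by simp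
  moreover have "safe (ext D ?q) (new D)"
  proof (cases "output_node D u")
    case True
    then show ?thesis
      using extends_output_node[OF e v(4)] by (simp add: safe_def shift_node_def)
  next
    case False
    then have u: "lab D u = LUnion" "odepth D u = 1" "odepth D (rchild D u) \<le> 2"
      using v by auto
    have r: "shift_node D (rchild D u)"
      using \<open>safe D v\<close> False v by (simp add: safe_def Let_def)
    then have "rchild D u \<in> nodes D"
      by (simp add: shift_node_def)
    then show ?thesis
      using u r v extends_lab[OF e] odepth_ext_old[OF sD wf]
      by (simp add: safe_def Let_def shift_node_def union_node_def)
  qed
  ultimately show ?thesis
    using i Shift v by simp
next
  case (Union v w)
  note sD = tame_shift_ecs[OF D]
  have sv: "safe D v" and sw: "safe D w"
    using safe Union by simp_all
  obtain k u where v: "v \<in> nodes D" "lab D v = LShift k" "left D v = Some u" "u \<in> nodes D"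
    "odepth D u \<le> 1"
    "output_node D u \<or> lab D u = LUnion \<and> odepth D u = 1 \<and> odepth D (rchild D u) \<le> 2"
    by (rule safe_cases[OF sD sv])
  obtain l t where w: "w \<in> nodes D" "lab D w = LShift l" "left D w = Some t" "t \<in> nodes D"
    "odepth D t \<le> 1"
    "output_node D t \<or> lab D t = LUnion \<and> odepth D t = 1 \<and> odepth D (rchild D t) \<le> 2"
    by (rule safe_cases[OF sD sw])
  have "sh (den D u) k \<inter> sh (den D t) l = {}"
    using q Union den_shift[OF sD v(1,2)] den_shift[OF sD w(1,2)] v w by simp
  then have disj: "den D u \<inter> sh (den D t) (l - k) = {}"
    by (simp only: sh_disjoint_iff)
  note disj = disj sh_disjoint_swap[OF disj]
  have "impl D q = (if output_node D u then graft D u k t l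
      else if output_node D t then graft D t l u k
      else if lab D u = LUnion \<and> lab D t = LUnion then interleave D u k t l
      else (ext D q, new D))"
    by (simp add: Union v(2,3) w(2,3))
  note i = trans[OF this[symmetric] i]
  consider "output_node D u" | "\<not> output_node D u" "output_node D t"
    | "\<not> output_node D u" "\<not> output_node D t"
    by blast
  then show ?thesis
  proof cases
    case 1
    then have "graft D u k t l = (D', v')"
      using i by simp
    then show ?thesis
      by (rule graft_safe[OF D v(4) w(4) _ 1 w(5) disj(1)])
  next
    case 2
    then have "graft D t l u k = (D', v')"
      using i by simp
    then show ?thesis
      by (rule graft_safe[OF D w(4) v(4) _ 2(2) v(5) disj(2)])
  next
    case 3
    then have ut: "lab D u = LUnion" "odepth D u = 1" "odepth D (rchild D u) \<le> 2"
        "lab D t = LUnion" "odepth D t = 1"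
      using v(6) w(6) by simp_all
    then have "interleave D u k t l = (D', v')"
      using i 3 by simp
    then show ?thesis
      by (rule interleave_safe[OF D v(4) ut(1) w(4) ut(4) _ ut(2,3,5) disj(1)])
  qed
qed

text \<open>Safety is demanded of the arguments at each request and is no invariant; what has to
  survive at every node, auxiliary ones included, is \<open>tame\<close>.\<close>

lemma safely_built_tame: "safely_built impl \<Omega> D \<Longrightarrow> tame D \<and> alphabet D = \<Omega>"
proof (induction rule: safely_built.induct)
  case (empty D)
  then show ?case
    by (simp add: tame_def)
next
  case (apply_request D q)
  obtain D' v' where i: "impl D q = (D', v')"
    by fastforce
  have "implements D D' v' (result_set D q)"
    using implements_impl[OF tame_shift_ecs admissible_well_formed i] apply_request by blast
  then show ?case
    using impl_safe[OF _ _ _ i] apply_request i by (auto simp: implements_def extends_def)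
qed

section \<open>Constant-time programs\<close>

text \<open>As \<open>stores\<close>, but with the first free address \<open>F\<close> not yet committed to cell \<open>0\<close>.\<close>

definition laid_out ::
  "('o \<Rightarrow> int) \<Rightarrow> ('v \<Rightarrow> int) \<Rightarrow> int \<Rightarrow> ('o, 'v) ecs \<Rightarrow> (int \<Rightarrow> int) \<Rightarrow> bool" where
  "laid_out enc addr F D M \<longleftrightarrow> stores enc addr D (M(0 := F))"

lemma stores_frame:
  assumes "stores enc addr D M" "\<And>a. 0 < a \<Longrightarrow> a < M 0 \<Longrightarrow> M' a = M a" "M' 0 = M 0"
  shows "stores enc addr D M'"
proof -
  have "M' (addr v + i) = M (addr v + i)" if "v \<in> nodes D" "0 \<le> i" "i < 4" for v i
    using assms that by (auto simp: stores_def)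
  from this[of _ 0] this[of _ 1] this[of _ 2] this[of _ 3] show ?thesis
    using assms(1,3) unfolding stores_def by simp
qed

lemma laid_out_frame:
  assumes "stores enc addr D M" "\<And>a. 0 < a \<Longrightarrow> a < M 0 \<Longrightarrow> M' a = M a"
  shows "laid_out enc addr (M 0) D M'"
  unfolding laid_out_def by (rule stores_frame[OF assms(1)]) (use assms(2) in auto)

fun cell_at :: "('o \<Rightarrow> int) \<Rightarrow> ('v \<Rightarrow> int) \<Rightarrow> (int \<Rightarrow> int) \<Rightarrow> int \<Rightarrow> ('o, 'v) request \<Rightarrow> bool" where
  "cell_at enc addr M F (Add x) \<longleftrightarrow> M F = 0 \<and> M (F + 1) = enc x"
| "cell_at enc addr M F (Prod v w) \<longleftrightarrow> M F = 1 \<and> M (F + 2) = addr v \<and> M (F + 3) = addr w"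
| "cell_at enc addr M F (Union v w) \<longleftrightarrow> M F = 2 \<and> M (F + 2) = addr v \<and> M (F + 3) = addr w"
| "cell_at enc addr M F (Shift v k) \<longleftrightarrow> M F = 3 \<and> M (F + 1) = k \<and> M (F + 2) = addr v"

text \<open>The memory \<open>M\<close> stays fixed while the structure and the frontier
  \<open>F\<close> grow: in the final memory of a program all new cells are already written, and
  they are taken into the structure one after another. Node names bear no relation to addresses;
  \<open>addr\<close> is extended at the new name.\<close>

lemma laid_out_ext:
  assumes lo: "laid_out enc addr F D M" and D: "shift_ecs D" and q: "well_formed D q"
    and cell: "cell_at enc addr M F q"
  shows "laid_out enc (addr(new D := F)) (F + 4) (ext D q) M"
proof -
  let ?a = "addr(new D := F)" and ?M = "M(0 := F + 4)"
  have F: "0 < F"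
    using lo by (simp add: laid_out_def stores_def)
  have new: "new D \<notin> nodes D"
    using D by (rule new_notin)
  have range: "0 < addr v \<and> addr v + 4 \<le> F" if "v \<in> nodes D" for v
    using lo that by (simp add: laid_out_def stores_def)
  have old: "0 < ?a v \<and> ?a v + 4 \<le> F + 4 \<and> ?M (?a v) = tag (lab (ext D q) v) \<and>
        (\<forall>x. lab (ext D q) v = LBottom x \<longrightarrow> ?M (?a v + 1) = enc x) \<and>
        (\<forall>k. lab (ext D q) v = LShift k \<longrightarrow> ?M (?a v + 1) = k) \<and>
        (\<forall>u. left (ext D q) v = Some u \<longrightarrow> ?M (?a v + 2) = ?a u) \<and>
        (\<forall>u. right (ext D q) v = Some u \<longrightarrow> ?M (?a v + 3) = ?a u)" if v: "v \<in> nodes D" for v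
  proof -
    have "v \<noteq> new D"
      using v new by blast
    moreover have "u \<noteq> new D" if "left D v = Some u \<or> right D v = Some u" for u
      using D that new by (auto simp: shift_ecs_def children_def)
    ultimately show ?thesis
      using lo v range[OF v] extends_lab[OF extends_ext[OF D] v]
      unfolding laid_out_def stores_def by auto
  qed
  have "0 < ?a (new D) \<and> ?a (new D) + 4 \<le> F + 4 \<and> ?M (?a (new D)) = tag (node_label q) \<and>
        (\<forall>x. node_label q = LBottom x \<longrightarrow> ?M (?a (new D) + 1) = enc x) \<and>
        (\<forall>k. node_label q = LShift k \<longrightarrow> ?M (?a (new D) + 1) = k) \<and>
        (\<forall>u. node_left q = Some u \<longrightarrow> ?M (?a (new D) + 2) = ?a u) \<and>
        (\<forall>u. node_right q = Some u \<longrightarrow> ?M (?a (new D) + 3) = ?a u)"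
    using cell q F new by (cases q) auto
  moreover have "\<forall>u\<in>nodes D. \<forall>v\<in>nodes D. u \<noteq> v \<longrightarrow> addr u + 4 \<le> addr v \<or> addr v + 4 \<le> addr u"
    using lo by (simp add: laid_out_def stores_def)
  ultimately show ?thesis
    using old F range new unfolding laid_out_def stores_def by auto
qed

text \<open>Register 5 holds the address of the next cell to write, registers 6 and 7 the constants
  1 and 0.\<close>

definition write_cell :: "nat \<Rightarrow> nat \<Rightarrow> nat \<Rightarrow> nat \<Rightarrow> program" where
  "write_cell a b c d = [Store 5 a, Plus 5 5 6, Store 5 b, Plus 5 5 6,
     Store 5 c, Plus 5 5 6, Store 5 d, Plus 5 5 6]"

definition prologue :: program where
  "prologue = [Const 6 1, Const 7 0, Load 5 7, Const 8 3]"

definition add_prog :: program where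
  "add_prog = prologue @ [Move 9 5] @ write_cell 7 0 7 7 @ [Move 0 5] @ write_cell 8 7 9 7 @
     [Store 7 5]"

definition prod_prog :: program where
  "prod_prog = prologue @ [Move 9 5] @ write_cell 6 7 0 1 @ [Move 0 5] @ write_cell 8 7 9 7 @
     [Store 7 5]"

definition shift_prog :: program where
  "shift_prog = prologue @ [Load 9 0, Minus 9 9 8, JumpZero 9 8, Jump 13,
     Plus 0 0 6, Load 9 0, Plus 1 1 9, Plus 0 0 6, Load 0 0,
     Move 9 5] @ write_cell 8 1 0 7 @ [Move 0 9, Store 7 5]"

text \<open>Register 8 holds the tag 3 of shift nodes and register 20 the tag 2 of union nodes. A plain
  union node is written from instruction 32 on, the nodes that \<open>interleave\<close> adds before grafting
  from 45 on; \<open>graft\<close> starts at 88, or at 83 with the arguments exchanged.\<close>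

definition union_prog :: program where
  "union_prog = prologue @
    [Load 9 0, Minus 9 9 8, JumpZero 9 8, Jump 32,
     Load 9 1, Minus 9 9 8, JumpZero 9 12, Jump 32,
     Plus 10 0 6, Load 12 10, Plus 10 10 6, Load 13 10,
     Plus 10 1 6, Load 14 10, Plus 10 10 6, Load 15 10,
     Minus 16 14 12, Minus 17 12 14,
     Load 18 13, Load 19 15, Const 20 2,
     Minus 18 20 18, JumpPos 18 88,
     Minus 19 20 19, JumpPos 19 83,
     JumpZero 18 31, Jump 32, JumpZero 19 45] @
    [Const 20 2, Move 9 5] @ write_cell 20 7 0 1 @ [Move 0 9, Store 7 5, Jump 116] @
    [Plus 10 13 6, Plus 10 10 6, Load 13 10, Plus 10 10 6, Load 21 10,
     Plus 10 15 6, Plus 10 10 6, Load 22 10, Plus 10 10 6, Load 23 10] @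
    [Move 24 5] @ write_cell 8 17 21 7 @ [Move 25 5] @ write_cell 20 7 24 23 @
    [Move 15 5] @ write_cell 20 7 22 25 @ [Jump 88] @
    [Move 12 14, Move 9 13, Move 13 15, Move 15 9, Move 16 17] @
    [Move 24 5] @ write_cell 8 16 15 7 @ [Move 25 5] @ write_cell 20 7 13 24 @
    [Move 0 5] @ write_cell 8 12 25 7 @ [Store 7 5]"

fun op_prog :: "kind \<Rightarrow> program" where
  "op_prog KAdd = add_prog"
| "op_prog KProd = prod_prog"
| "op_prog KUnion = union_prog"
| "op_prog KShift = shift_prog"

section \<open>Symbolic execution of the operations\<close>

lemma run_0 [simp]: "run P 0 s = s"
  by (simp add: run_def)

lemma run_Suc: "run P (Suc n) s = run P n (step P s)"
  by (simp add: run_def funpow_swap1)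

lemma run_numeral: "run P (numeral w) s = run P (pred_numeral w) (step P s)"
  by (simp add: numeral_eq_Suc run_Suc)

lemma run_add: "run P (m + n) s = run P n (run P m s)"
  unfolding run_def by (subst add.commute) (simp add: funpow_add)

definition computes :: "program \<Rightarrow> nat \<Rightarrow> (nat \<Rightarrow> int) \<Rightarrow> (int \<Rightarrow> int) \<Rightarrow> (int \<Rightarrow> int) \<Rightarrow> int \<Rightarrow> bool" where
  "computes P n R M M' r \<longleftrightarrow> (\<exists>R'. run P n (start R M) =
     \<lparr>pc = length P, regs = R', mem = M', buf = [], outs = []\<rparr> \<and> R' 0 = r)"

definition put :: "int \<Rightarrow> int \<Rightarrow> int \<Rightarrow> int \<Rightarrow> int \<Rightarrow> (int \<Rightarrow> int) \<Rightarrow> int \<Rightarrow> int" where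
  "put F a b c d M = M(F := a, F + 1 := b, F + 2 := c, F + 3 := d)"

lemmas simulate = computes_def run_numeral run_Suc step_def halted_def start_def
  prologue_def write_cell_def put_def add.commute

text \<open>A halted machine stays as it is, so the count 100 serves all programs and branches
  alike. In each program the loads precede the stores, so the new cells are described by the initial
  memory alone.\<close>

lemma add_prog_computes:
  "computes add_prog 100 R M
    ((put (M 0 + 4) 3 0 (M 0) 0 (put (M 0) 0 (R 0) 0 0 M))(0 := M 0 + 8)) (M 0 + 4)"
  by (simp add: simulate add_prog_def)

lemma prod_prog_computes:
  "computes prod_prog 100 R M
    ((put (M 0 + 4) 3 0 (M 0) 0 (put (M 0) 1 0 (R 0) (R 1) M))(0 := M 0 + 8)) (M 0 + 4)"
  by (simp add: simulate prod_prog_def)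

lemma shift_prog_computes:
  "M (R 0) = 3 \<Longrightarrow> computes shift_prog 100 R M
    ((put (M 0) 3 (R 1 + M (R 0 + 1)) (M (R 0 + 2)) 0 M)(0 := M 0 + 4)) (M 0)"
  "M (R 0) \<noteq> 3 \<Longrightarrow> computes shift_prog 100 R M
    ((put (M 0) 3 (R 1) (R 0) 0 M)(0 := M 0 + 4)) (M 0)"
  by (simp_all add: simulate shift_prog_def)

lemma union_prog_computes_plain:
  assumes "M (R 0) \<noteq> 3 \<or> M (R 1) \<noteq> 3 \<or>
    M (M (R 0 + 2)) \<ge> 2 \<and> M (M (R 1 + 2)) \<ge> 2 \<and>
    (M (M (R 0 + 2)) \<noteq> 2 \<or> M (M (R 1 + 2)) \<noteq> 2)"
  shows "computes union_prog 100 R M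
    ((put (M 0) 2 0 (R 0) (R 1) M)(0 := M 0 + 4)) (M 0)"
proof -
  consider "M (R 0) \<noteq> 3" | "M (R 0) = 3" "M (R 1) \<noteq> 3"
    | "M (R 0) = 3" "M (R 1) = 3" "M (M (R 0 + 2)) > 2" "M (M (R 1 + 2)) \<ge> 2"
    | "M (R 0) = 3" "M (R 1) = 3" "M (M (R 0 + 2)) = 2" "M (M (R 1 + 2)) > 2"
    using assms by linarith
  then show ?thesis
    by cases (simp_all add: simulate union_prog_def)
qed

lemma union_prog_computes_graft:
  assumes "M (R 0) = 3" "M (R 1) = 3"
  shows "M (M (R 0 + 2)) < 2 \<Longrightarrow> computes union_prog 100 R M
     ((put (M 0 + 8) 3 (M (R 0 + 1)) (M 0 + 4) 0
       (put (M 0 + 4) 2 0 (M (R 0 + 2)) (M 0)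
         (put (M 0) 3 (M (R 1 + 1) - M (R 0 + 1)) (M (R 1 + 2)) 0 M)))(0 := M 0 + 12)) (M 0 + 8)"
    and "M (M (R 0 + 2)) \<ge> 2 \<Longrightarrow> M (M (R 1 + 2)) < 2 \<Longrightarrow> computes union_prog 100 R M
     ((put (M 0 + 8) 3 (M (R 1 + 1)) (M 0 + 4) 0
       (put (M 0 + 4) 2 0 (M (R 1 + 2)) (M 0)
         (put (M 0) 3 (M (R 0 + 1) - M (R 1 + 1)) (M (R 0 + 2)) 0 M)))(0 := M 0 + 12)) (M 0 + 8)"
  using assms by (simp_all add: simulate union_prog_def)

lemma union_prog_computes_interleave:
  assumes "M (R 0) = 3" "M (R 1) = 3" "M (M (R 0 + 2)) = 2" "M (M (R 1 + 2)) = 2"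
  shows "computes union_prog 100 R M
     ((put (M 0 + 20) 3 (M (R 0 + 1)) (M 0 + 16) 0
       (put (M 0 + 16) 2 0 (M (M (R 0 + 2) + 2)) (M 0 + 12)
        (put (M 0 + 12) 3 (M (R 1 + 1) - M (R 0 + 1)) (M 0 + 8) 0
         (put (M 0 + 8) 2 0 (M (M (R 1 + 2) + 2)) (M 0 + 4)
          (put (M 0 + 4) 2 0 (M 0) (M (M (R 1 + 2) + 3))
           (put (M 0) 3 (M (R 0 + 1) - M (R 1 + 1)) (M (M (R 0 + 2) + 3)) 0 M))))))(0 := M 0 + 24))
     (M 0 + 20)"
  using assms by (simp add: simulate union_prog_def)

lemma stores_nodeD:
  assumes "stores enc addr D M" "v \<in> nodes D"
  shows "0 < addr v" "addr v + 4 \<le> M 0" "M (addr v) = tag (lab D v)"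
    "lab D v = LBottom x \<Longrightarrow> M (addr v + 1) = enc x"
    "lab D v = LShift k \<Longrightarrow> M (addr v + 1) = k"
    "left D v = Some u \<Longrightarrow> M (addr v + 2) = addr u"
    "right D v = Some u \<Longrightarrow> M (addr v + 3) = addr u"
  using assms by (auto simp: stores_def)

text \<open>The tags of output nodes are the two smallest, so \<open>union_prog\<close> looks at the
  sign of 2 minus the tag: positive means output node, zero means union.\<close>

lemma stores_tag:
  assumes "stores enc addr D M" "v \<in> nodes D"
  shows "output_node D v \<longleftrightarrow> M (addr v) < 2" "lab D v = LUnion \<longleftrightarrow> M (addr v) = 2"
  using assms(2) stores_nodeD(3)[OF assms] by (cases "lab D v"; auto simp: output_node_lab)+

definition realizes ::
  "('o \<Rightarrow> int) \<Rightarrow> ('v \<Rightarrow> int) \<Rightarrow> ('o, 'v) ecs \<Rightarrow> ('o, 'v) ecs \<Rightarrow> 'v \<Rightarrow> (int \<Rightarrow> int) \<Rightarrow> int \<Rightarrow> bool"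
  where
  "realizes enc addr D D' v' M' r \<longleftrightarrow>
     (\<exists>addr'. stores enc addr' D' M' \<and> (\<forall>u\<in>nodes D. addr' u = addr u) \<and> r = addr' v')"

lemma performsI:
  assumes "\<And>addr M R. stores enc addr D M \<Longrightarrow> passes enc addr q R \<Longrightarrow>
    \<exists>M' r. computes P n R M M' r \<and> realizes enc addr D D' v' M' r" and "n \<le> c"
  shows "performs enc P c D q D' v'"
  unfolding performs_def
proof (intro allI impI)
  fix addr M R
  assume "stores enc addr D M \<and> passes enc addr q R"
  then obtain M' r addr' where "computes P n R M M' r" "stores enc addr' D' M'"
    "\<forall>u\<in>nodes D. addr' u = addr u" "r = addr' v'"
    using assms(1) unfolding realizes_def by blast
  then have "let s = run P n (start R M) in halted P s \<and> stores enc addr' D' (mem s) \<and>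
      (\<forall>u\<in>nodes D. addr' u = addr u) \<and> regs s 0 = addr' v'"
    by (auto simp: computes_def halted_def)
  then show "\<exists>n\<le>c. \<exists>addr'. let s = run P n (start R M) in halted P s \<and> stores enc addr' D' (mem s) \<and>
      (\<forall>u\<in>nodes D. addr' u = addr u) \<and> regs s 0 = addr' v'"
    using assms(2) by blast
qed

lemma realizes_ext:
  assumes "laid_out enc addr F D M" "shift_ecs D" "well_formed D q" "cell_at enc addr M F q"
    and "F' = F + 4"
  shows "realizes enc addr D (ext D q) (new D) (M(0 := F')) F"
  using laid_out_ext[OF assms(1-4)] new_notin[OF assms(2)] assms(5)
  unfolding realizes_def laid_out_def by (intro exI[of _ "addr(new D := F)"]) auto

lemma realizes_extends:
  assumes "realizes enc addr' D1 D' v' M' r" "extends D D1" "\<And>u. u \<in> nodes D \<Longrightarrow> addr' u = addr u"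
  shows "realizes enc addr D D' v' M' r"
  using assms extends_nodes[OF assms(2)] unfolding realizes_def by metis

lemma realizes_wrap:
  assumes lo: "laid_out enc addr F D M" and D: "shift_ecs D" and q: "well_formed D q"
    and c: "cell_at enc addr M F q" "M (F + 4) = 3" "M (F + 5) = 0" "M (F + 6) = F"
  shows "realizes enc addr D (ext (ext D q) (Shift (new D) 0)) (new (ext D q)) (M(0 := F + 8)) (F + 4)"
proof -
  have "realizes enc (addr(new D := F)) (ext D q) (ext (ext D q) (Shift (new D) 0)) (new (ext D q))
      (M(0 := F + 8)) (F + 4)"
    by (rule realizes_ext[OF laid_out_ext[OF lo D q c(1)] shift_ecs_ext[OF D q]])
      (use c in \<open>simp_all add: add.assoc\<close>)
  then show ?thesis
    by (rule realizes_extends[OF _ extends_ext[OF D]]) (use new_notin[OF D] in auto)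
qed

lemma realizes_graft:
  assumes lo: "laid_out enc addr F D M" and D: "shift_ecs D" and u: "u \<in> nodes D" and t: "t \<in> nodes D"
    and g: "graft D u k t l = (D', v')"
    and c: "M F = 3" "M (F + 1) = l - k" "M (F + 2) = addr t"
      "M (F + 4) = 2" "M (F + 6) = addr u" "M (F + 7) = F"
      "M (F + 8) = 3" "M (F + 9) = k" "M (F + 10) = F + 4"
  shows "realizes enc addr D D' v' (M(0 := F + 12)) (F + 8)"
proof -
  define D1 where "D1 = ext D (Shift t (l - k))"
  define D2 where "D2 = ext D1 (Union u (new D))"
  let ?a1 = "addr(new D := F)"
  let ?a2 = "?a1(new D1 := F + 4)"
  have D1: "shift_ecs D1"
    unfolding D1_def by (rule shift_ecs_ext[OF D]) (use t in simp)
  have q2: "well_formed D1 (Union u (new D))"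
    using u by (simp add: D1_def)
  have D2: "shift_ecs D2"
    using D1 q2 unfolding D2_def by (rule shift_ecs_ext)
  have new: "new D \<notin> nodes D" "new D1 \<notin> nodes D1"
    using D D1 by (simp_all add: new_notin)
  have "laid_out enc ?a1 (F + 4) D1 M"
    unfolding D1_def by (rule laid_out_ext[OF lo D]) (use t c in simp_all)
  then have "laid_out enc ?a2 (F + 4 + 4) D2 M"
    unfolding D2_def by (rule laid_out_ext[OF _ D1 q2]) (use c u new in \<open>auto simp: add.assoc\<close>)
  then have "realizes enc ?a2 D2 (ext D2 (Shift (new D1) k)) (new D2) (M(0 := F + 12)) (F + 4 + 4)"
    by (rule realizes_ext[OF _ D2]) (use c in \<open>auto simp: D2_def add.assoc\<close>)
  moreover have "D' = ext D2 (Shift (new D1) k)" "v' = new D2"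
    using g by (auto simp: graft_def Let_def D1_def D2_def)
  ultimately have "realizes enc ?a2 D2 D' v' (M(0 := F + 12)) (F + 8)"
    by (simp add: add.assoc)
  then show ?thesis
    by (rule realizes_extends)
      (use new extends_trans[OF extends_ext[OF D] extends_ext] D1 in \<open>auto simp: D1_def D2_def\<close>)
qed

lemma realizes_interleave:
  assumes lo: "laid_out enc addr F D M" and D: "shift_ecs D"
    and u: "u \<in> nodes D" "lab D u = LUnion" and t: "t \<in> nodes D" "lab D t = LUnion"
    and g: "interleave D u k t l = (D', v')"
    and c: "M F = 3" "M (F + 1) = k - l" "M (F + 2) = addr (rchild D u)"
      "M (F + 4) = 2" "M (F + 6) = F" "M (F + 7) = addr (rchild D t)"
      "M (F + 8) = 2" "M (F + 10) = addr (lchild D t)" "M (F + 11) = F + 4"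
      "M (F + 12) = 3" "M (F + 13) = l - k" "M (F + 14) = F + 8"
      "M (F + 16) = 2" "M (F + 18) = addr (lchild D u)" "M (F + 19) = F + 12"
      "M (F + 20) = 3" "M (F + 21) = k" "M (F + 22) = F + 16"
  shows "realizes enc addr D D' v' (M(0 := F + 24)) (F + 20)"
proof -
  define D1 where "D1 = ext D (Shift (rchild D u) (k - l))"
  define D2 where "D2 = ext D1 (Union (new D) (rchild D t))"
  define D3 where "D3 = ext D2 (Union (lchild D t) (new D1))"
  let ?a1 = "addr(new D := F)"
  let ?a2 = "?a1(new D1 := F + 4)"
  let ?a3 = "?a2(new D2 := F + 8)"
  note p = interleave_prefix[OF D u t D1_def D2_def D3_def]
  have lr: "lchild D u \<in> nodes D" "rchild D u \<in> nodes D" "lchild D t \<in> nodes D" "rchild D t \<in> nodes D"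
    using node_children(2)[OF D u] node_children(2)[OF D t] by auto
  have D1: "shift_ecs D1"
    unfolding D1_def by (rule shift_ecs_ext[OF D]) (use lr in simp)
  have q2: "well_formed D1 (Union (new D) (rchild D t))"
    using lr by (simp add: D1_def)
  have D2: "shift_ecs D2"
    using D1 q2 unfolding D2_def by (rule shift_ecs_ext)
  have q3: "well_formed D2 (Union (lchild D t) (new D1))"
    using lr by (simp add: D1_def D2_def)
  have n12: "nodes D1 = insert (new D) (nodes D)" "nodes D2 = insert (new D1) (nodes D1)"
    by (simp_all add: D1_def D2_def)
  have new: "new D \<notin> nodes D" "new D1 \<notin> nodes D1" "new D2 \<notin> nodes D2"
    using D D1 D2 by (simp_all add: new_notin)
  have old: "v \<noteq> new D \<and> v \<noteq> new D1 \<and> v \<noteq> new D2" if "v \<in> nodes D" for v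
    using that new n12 by auto
  have "new D1 \<noteq> new D"
    using new n12 by auto
  have "laid_out enc ?a1 (F + 4) D1 M"
    unfolding D1_def by (rule laid_out_ext[OF lo D]) (use lr c in simp_all)
  then have "laid_out enc ?a2 (F + 4 + 4) D2 M"
    unfolding D2_def
    by (rule laid_out_ext[OF _ D1 q2]) (use c old[OF lr(4)] in \<open>simp add: add.assoc\<close>)
  then have "laid_out enc ?a3 (F + 8 + 4) D3 M"
    unfolding D3_def
    using laid_out_ext[OF _ D2 q3, of enc ?a2 "F + 8"] c old[OF lr(3)] by (simp add: add.assoc)
  moreover have "graft D3 (lchild D u) k (new D2) l = (D', v')"
    using g by (simp add: interleave_def Let_def D1_def D2_def D3_def)
  ultimately have "realizes enc ?a3 D3 D' v' (M(0 := F + 8 + 4 + 12)) (F + 8 + 4 + 8)"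
    by (rule realizes_graft[OF _ p(1,3,4)]) (use c old[OF lr(1)] in \<open>simp_all add: add.assoc\<close>)
  then have "realizes enc ?a3 D3 D' v' (M(0 := F + 24)) (F + 20)"
    by (simp add: add.assoc)
  then show ?thesis
    by (rule realizes_extends[OF _ p(2)]) (use old in auto)
qed

lemma impl_performs:
  assumes D: "shift_ecs D" and q: "well_formed D q" and i: "impl D q = (D', v')" and c: "100 \<le> c"
  shows "performs enc (op_prog (kind_of q)) c D q D' v'"
proof (rule performsI[OF _ c])
  fix addr M R
  assume st: "stores enc addr D M" and R: "passes enc addr q R"
  have F: "0 < M 0"
    using st by (simp add: stores_def)
  note lo = laid_out_frame[OF st]
  show "\<exists>M' r. computes (op_prog (kind_of q)) 100 R M M' r \<and> realizes enc addr D D' v' M' r"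
  proof (cases q)
    case (Add x)
    have "realizes enc addr D (ext (ext D q) (Shift (new D) 0)) (new (ext D q))
        ((put (M 0 + 4) 3 0 (M 0) 0 (put (M 0) 0 (R 0) 0 0 M))(0 := M 0 + 8)) (M 0 + 4)"
      by (rule realizes_wrap[OF lo D q]) (use F R Add in \<open>simp_all add: put_def\<close>)
    then show ?thesis
      using add_prog_computes[of R M] i Add by (auto simp: Let_def)
  next
    case (Prod v w)
    have "realizes enc addr D (ext (ext D q) (Shift (new D) 0)) (new (ext D q))
        ((put (M 0 + 4) 3 0 (M 0) 0 (put (M 0) 1 0 (R 0) (R 1) M))(0 := M 0 + 8)) (M 0 + 4)"
      by (rule realizes_wrap[OF lo D q]) (use F R Prod in \<open>simp_all add: put_def\<close>)
    then show ?thesis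
      using prod_prog_computes[of R M] i Prod by (auto simp: Let_def)
  next
    case (Shift v k)
    have v: "v \<in> nodes D" and R: "R 0 = addr v" "R 1 = k"
      using q R Shift by simp_all
    note mv = stores_nodeD[OF st v]
    show ?thesis
    proof (cases "\<exists>j. lab D v = LShift j")
      case True
      then obtain j where j: "lab D v = LShift j" ..
      obtain u where u: "left D v = Some u" "u \<in> nodes D"
        using node_children(1)[OF D v j] by blast
      have "realizes enc addr D (ext D (Shift u (k + j))) (new D)
          ((put (M 0) 3 (k + j) (addr u) 0 M)(0 := M 0 + 4)) (M 0)"
        by (rule realizes_ext[OF lo D]) (use F u in \<open>simp_all add: put_def\<close>)
      then show ?thesis
        using shift_prog_computes(1)[of M R] i Shift R j u mv(3) mv(5)[OF j] mv(6)[OF u(1)] by auto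
    next
      case False
      then have "impl D q = (ext D q, new D)" and "M (addr v) \<noteq> 3"
        using Shift mv(3) by (cases "lab D v"; simp)+
      moreover have "realizes enc addr D (ext D q) (new D)
          ((put (M 0) 3 k (addr v) 0 M)(0 := M 0 + 4)) (M 0)"
        by (rule realizes_ext[OF lo D q]) (use F Shift in \<open>simp_all add: put_def\<close>)
      ultimately show ?thesis
        using shift_prog_computes(2)[of M R] i Shift R by auto
    qed
  next
    case (Union v w)
    have v: "v \<in> nodes D" and w: "w \<in> nodes D" and R: "R 0 = addr v" "R 1 = addr w"
      using q R Union by simp_all
    note mv = stores_nodeD[OF st v] and mw = stores_nodeD[OF st w]
    have plain: "realizes enc addr D (ext D q) (new D)
        ((put (M 0) 2 0 (addr v) (addr w) M)(0 := M 0 + 4)) (M 0)"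
      by (rule realizes_ext[OF lo D q]) (use F Union in \<open>simp_all add: put_def\<close>)
    show ?thesis
    proof (cases "\<exists>k l. lab D v = LShift k \<and> lab D w = LShift l")
      case False
      then have "impl D q = (ext D q, new D)"
        using Union by (cases "lab D v"; cases "lab D w"; simp)
      moreover have "M (addr v) \<noteq> 3 \<or> M (addr w) \<noteq> 3"
        using False mv(3) mw(3) by (cases "lab D v"; cases "lab D w"; simp)
      ultimately show ?thesis
        using union_prog_computes_plain[of M R] plain i Union R by auto
    next
      case True
      then obtain k l where k: "lab D v = LShift k" and l: "lab D w = LShift l"
        by blast
      obtain u where u: "left D v = Some u" "u \<in> nodes D"
        using node_children(1)[OF D v k] by blast
      obtain t where t: "left D w = Some t" "t \<in> nodes D"
        using node_children(1)[OF D w l] by blast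
      note mu = stores_nodeD[OF st u(2)] and mt = stores_nodeD[OF st t(2)]
      have cells: "M (addr v) = 3" "M (addr v + 1) = k" "M (addr v + 2) = addr u"
          "M (addr w) = 3" "M (addr w + 1) = l" "M (addr w + 2) = addr t"
        using mv(3,5,6) mw(3,5,6) k l u(1) t(1) by simp_all
      have "impl D q = (if output_node D u then graft D u k t l
          else if output_node D t then graft D t l u k
          else if lab D u = LUnion \<and> lab D t = LUnion then interleave D u k t l
          else (ext D q, new D))"
        by (simp add: Union k l u t)
      note i = trans[OF this[symmetric] i]
      have out: "output_node D u \<longleftrightarrow> M (addr u) < 2" "output_node D t \<longleftrightarrow> M (addr t) < 2"
          "lab D u = LUnion \<longleftrightarrow> M (addr u) = 2" "lab D t = LUnion \<longleftrightarrow> M (addr t) = 2"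
        using stores_tag[OF st u(2)] stores_tag[OF st t(2)] by simp_all
      consider (left_output) "output_node D u"
        | (right_output) "\<not> output_node D u" "output_node D t"
        | (unions) "\<not> output_node D u" "\<not> output_node D t" "lab D u = LUnion" "lab D t = LUnion"
        | (other) "\<not> output_node D u" "\<not> output_node D t" "\<not> (lab D u = LUnion \<and> lab D t = LUnion)"
        by blast
      then show ?thesis
      proof cases
        case left_output
        then have g: "graft D u k t l = (D', v')"
          using i by simp
        have "realizes enc addr D D' v' ((put (M 0 + 8) 3 k (M 0 + 4) 0
            (put (M 0 + 4) 2 0 (addr u) (M 0) (put (M 0) 3 (l - k) (addr t) 0 M)))(0 := M 0 + 12))
            (M 0 + 8)"
          by (rule realizes_graft[OF lo D u(2) t(2) g]) (use F in \<open>simp_all add: put_def\<close>)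
        then show ?thesis
          using union_prog_computes_graft(1)[of M R] left_output Union cells out R by auto
      next
        case right_output
        then have g: "graft D t l u k = (D', v')"
          using i by simp
        have "realizes enc addr D D' v' ((put (M 0 + 8) 3 l (M 0 + 4) 0
            (put (M 0 + 4) 2 0 (addr t) (M 0) (put (M 0) 3 (k - l) (addr u) 0 M)))(0 := M 0 + 12))
            (M 0 + 8)"
          by (rule realizes_graft[OF lo D t(2) u(2) g]) (use F in \<open>simp_all add: put_def\<close>)
        then show ?thesis
          using union_prog_computes_graft(2)[of M R] right_output Union cells out R by auto
      next
        case unions
        then have g: "interleave D u k t l = (D', v')"
          using i by simp
        obtain a b where ab: "left D u = Some a" "right D u = Some b"
          using node_children(2)[OF D u(2) unions(3)] by blast
        obtain a' b' where ab': "left D t = Some a'" "right D t = Some b'"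
          using node_children(2)[OF D t(2) unions(4)] by blast
        have "realizes enc addr D D' v'
          ((put (M 0 + 20) 3 k (M 0 + 16) 0
            (put (M 0 + 16) 2 0 (addr a) (M 0 + 12)
             (put (M 0 + 12) 3 (l - k) (M 0 + 8) 0
              (put (M 0 + 8) 2 0 (addr a') (M 0 + 4)
               (put (M 0 + 4) 2 0 (M 0) (addr b')
                (put (M 0) 3 (k - l) (addr b) 0 M))))))(0 := M 0 + 24)) (M 0 + 20)"
          by (rule realizes_interleave[OF lo D u(2) unions(3) t(2) unions(4) g])
            (use F ab ab' in \<open>simp_all add: put_def\<close>)
        then show ?thesis
          using union_prog_computes_interleave[of M R] unions Union cells out R
            mu(6)[OF ab(1)] mu(7)[OF ab(2)] mt(6)[OF ab'(1)] mt(7)[OF ab'(2)] by auto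
      next
        case other
        then have "M (addr u) \<ge> 2 \<and> M (addr t) \<ge> 2 \<and> (M (addr u) \<noteq> 2 \<or> M (addr t) \<noteq> 2)"
          and "D' = ext D q" "v' = new D"
          using i out by auto
        then show ?thesis
          using union_prog_computes_plain[of M R] plain Union R cells by auto
      qed
    qed
  qed
qed

section \<open>Output-linear enumeration\<close>

lemma run_halted: "halted P s \<Longrightarrow> run P n s = s"
  by (induction n) (simp_all add: run_Suc step_def)

lemma run_Suc_step: "run P (Suc n) s = step P (run P n s)"
  by (simp add: run_def)

lemma outs_step: "length (outs s) \<le> length (outs (step P s))"
  by (cases "P ! pc s") (auto simp: step_def)

lemma outs_run_mono: "m \<le> n \<Longrightarrow> length (outs (run P m s)) \<le> length (outs (run P n s))"
  by (rule lift_Suc_mono_le[of "\<lambda>n. length (outs (run P n s))"])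
    (simp_all add: run_Suc_step outs_step)

text \<open>Measures each delay from the preceding output and fixes the step that completes a
  record, so proofs about programs can follow the run without the \<open>LEAST\<close> in
  \<open>completion_time\<close>. \<open>Q\<close> carries a property of the final memory.\<close>

inductive emits ::
  "program \<Rightarrow> nat \<Rightarrow> ((int \<Rightarrow> int) \<Rightarrow> bool) \<Rightarrow> state \<Rightarrow> (int \<times> int) list list \<Rightarrow> bool" for P c Q where
  stop: "\<lbrakk>halted P (run P T s); T \<le> c; outs (run P T s) = outs s; buf (run P T s) = [];
    Q (mem (run P T s))\<rbrakk> \<Longrightarrow> emits P c Q s []"
| emit: "\<lbrakk>outs (run P n s) = outs s; outs (run P (Suc n) s) = outs s @ [w];
    Suc n \<le> c * length w; emits P c Q (run P (Suc n) s) ws\<rbrakk> \<Longrightarrow> emits P c Q s (w # ws)"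

lemma emits_delays:
  assumes "emits P c Q s' ws" "run P t s = s'" "completion_time P s (length (outs s')) = t"
  shows "\<exists>T. halted P (run P T s) \<and> outs (run P T s) = outs s' @ ws \<and> buf (run P T s) = [] \<and>
    Q (mem (run P T s)) \<and>
    (\<forall>j < length ws. completion_time P s (Suc (length (outs s') + j))
       \<le> completion_time P s (length (outs s') + j) + c * length (ws ! j)) \<and>
    T \<le> completion_time P s (length (outs s') + length ws) + c"
  using assms
proof (induction arbitrary: t rule: emits.induct)
  case (stop T s')
  then show ?case
    by (intro exI[of _ "t + T"]) (simp add: run_add)
next
  case (emit n s' w ws)
  let ?i = "length (outs s')"
  have run: "run P (t + m) s = run P m s'" for m
    using emit.prems by (simp add: run_add)
  \<comment> \<open>No record is completed during the first \<open>n\<close> steps, and the number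
    of outputs never decreases, so step \<open>n + 1\<close> is the earliest moment.\<close>
  have ct: "completion_time P s (Suc ?i) = t + Suc n"
    unfolding completion_time_def
  proof (rule Least_equality)
    show "Suc ?i \<le> length (outs (run P (t + Suc n) s))"
      unfolding run using emit.hyps(2) by simp
    fix m
    assume "Suc ?i \<le> length (outs (run P m s))"
    moreover have "length (outs (run P m s)) \<le> ?i" if "m \<le> t + n"
      using outs_run_mono[OF that, of P s] emit.hyps(1) unfolding run by simp
    ultimately show "t + Suc n \<le> m"
      by linarith
  qed
  have "length (outs (run P (Suc n) s')) = Suc ?i"
    using emit.hyps(2) by simp
  then obtain T where T: "halted P (run P T s)" "outs (run P T s) = outs s' @ w # ws"
    "buf (run P T s) = []" "Q (mem (run P T s))"
    "\<forall>j < length ws. completion_time P s (Suc (Suc ?i + j))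
       \<le> completion_time P s (Suc ?i + j) + c * length (ws ! j)"
    "T \<le> completion_time P s (Suc ?i + length ws) + c"
    using emit.IH[OF run] ct emit.hyps(2) by auto
  have "completion_time P s (Suc (?i + j))
      \<le> completion_time P s (?i + j) + c * length ((w # ws) ! j)" if "j < length (w # ws)" for j
    using that T(5) ct emit.prems(2) emit.hyps(3) by (cases j) auto
  then show ?case
    using T by auto
qed

lemma emits_enumerates:
  assumes "emits P c Q (start R M) ws" "distinct ws"
  shows "enumerates_output_linear P c (start R M) (set ws)"
    and "halted P (run P n (start R M)) \<Longrightarrow> Q (mem (run P n (start R M)))"
proof -
  let ?s = "start R M"
  have 0: "completion_time P ?s 0 = 0" "outs ?s = []"
    by (simp_all add: completion_time_def start_def)
  obtain T where T: "halted P (run P T ?s)" "outs (run P T ?s) = ws" "buf (run P T ?s) = []"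
    "Q (mem (run P T ?s))"
    "\<forall>j < length ws. completion_time P ?s (Suc j) \<le> completion_time P ?s j + c * length (ws ! j)"
    "T \<le> completion_time P ?s (length ws) + c"
    using emits_delays[OF assms(1), of 0 ?s] 0 by auto
  then show "enumerates_output_linear P c ?s (set ws)"
    using assms(2) unfolding enumerates_output_linear_def by blast
  assume n: "halted P (run P n ?s)"
  \<comment> \<open>The machine rests once halted, so any two halting moments show the same
    state.\<close>
  have "run P n ?s = run P T ?s"
    using run_halted[OF T(1), of "n - T"] run_halted[OF n, of "T - n"]
      run_add[of P T "n - T" ?s] run_add[of P n "T - n" ?s] by (cases "n \<le> T") simp_all
  then show "Q (mem (run P n ?s))"
    using T(4) by simp
qed

section \<open>Unfolding nodes into trees\<close>

datatype 'a tree = Leaf 'a | Moved int "'a tree" | Alt "'a tree" "'a tree" | Cat "'a tree" "'a tree"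

definition shift_word :: "int \<Rightarrow> ('a \<times> int) list \<Rightarrow> ('a \<times> int) list" where
  "shift_word k = map (\<lambda>(x, i). (x, i + k))"

lemma shift_word_simps [simp]:
  "shift_word k [] = []"
  "shift_word k ((x, i) # w) = (x, i + k) # shift_word k w"
  "shift_word k (u @ w) = shift_word k u @ shift_word k w"
  "length (shift_word k w) = length w"
  "shift_word k (shift_word j w) = shift_word (k + j) w"
  by (simp_all add: shift_word_def split_def comp_def add_ac)

text \<open>Lists rather than sets, in the order of the machine: \<open>List.product\<close> varies
  its second list fastest, so the right factor, expanded first, forms the outer loop.\<close>

primrec words :: "'a tree \<Rightarrow> ('a \<times> int) list list" where
  "words (Leaf x) = [[(x, 1)]]"
| "words (Moved k t) = map (shift_word k) (words t)"
| "words (Alt a b) = words a @ words b"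
| "words (Cat a b) = map (\<lambda>(w, u). u @ w) (List.product (words b) (words a))"

primrec depth :: "'a tree \<Rightarrow> nat" where
  "depth (Leaf x) = 0"
| "depth (Moved k t) = Suc (depth t)"
| "depth (Alt a b) = Suc (depth a)"
| "depth (Cat a b) = 0"

text \<open>Bounds the left chains at every subtree, also in right alternatives and below products,
  where later descents start.\<close>

primrec shallow :: "'a tree \<Rightarrow> bool" where
  "shallow (Leaf x) \<longleftrightarrow> True"
| "shallow (Moved k t) \<longleftrightarrow> shallow t \<and> depth t < 4"
| "shallow (Alt a b) \<longleftrightarrow> shallow a \<and> shallow b \<and> depth a < 4"
| "shallow (Cat a b) \<longleftrightarrow> shallow a \<and> shallow b"

lemma shallow_depth: "shallow t \<Longrightarrow> depth t \<le> 4"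
  by (cases t) auto

primrec first_length :: "'a tree \<Rightarrow> nat" where
  "first_length (Leaf x) = 1"
| "first_length (Moved k t) = first_length t"
| "first_length (Alt a b) = first_length a"
| "first_length (Cat a b) = first_length a + first_length b"

text \<open>Right alternatives do not count: only the nodes expanded before the first word is
  complete, whose length is \<open>first_length\<close>.\<close>

primrec first_steps :: "'a tree \<Rightarrow> nat" where
  "first_steps (Leaf x) = 1"
| "first_steps (Moved k t) = Suc (first_steps t)"
| "first_steps (Alt a b) = Suc (first_steps a)"
| "first_steps (Cat a b) = Suc (first_steps a + first_steps b)"

text \<open>The induction carries a slack of 9 = 1 + 4 + 4: at a product the two hypotheses provide
  it twice, and the surplus pays for the product itself and for the left chains of its factors. The
  factor 10 is the cost of a leaf, one step plus the slack.\<close>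

lemma first_steps_bound:
  assumes "shallow t"
  shows "first_steps t \<le> 10 * first_length t"
proof -
  have "first_steps t + 9 \<le> depth t + 10 * first_length t"
    using assms
  proof (induction t)
    case (Cat a b)
    then show ?case
      using shallow_depth[of a] shallow_depth[of b] by simp
  qed auto
  then show ?thesis
    using shallow_depth[OF assms] by simp
qed

lemma shallow_map_tree [simp]: "depth (map_tree f t) = depth t" "shallow (map_tree f t) = shallow t"
  by (induction t) auto

lemma words_map_tree: "words (map_tree f t) = map (map (\<lambda>(x, i). (f x, i))) (words t)"
proof (induction t)
  case (Cat a b)
  have "map (\<lambda>(w, u). u @ w) (List.product (map (map g) ys) (map (map g) xs))
      = map (map g) (map (\<lambda>(w, u). u @ w) (List.product ys xs))" for g :: "'c \<Rightarrow> 'd" and xs ys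
    by (induction ys) (simp_all add: comp_def)
  then show ?case
    using Cat by simp
qed (simp_all add: shift_word_def comp_def split_def)

text \<open>The goal at the head is the factor standing directly in front of \<open>acc\<close>.
  Each goal carries its own accumulated shift: shifting distributes over concatenation, so both
  factors of a product inherit the same amount.\<close>

primrec goal_words :: "('a tree \<times> int) list \<Rightarrow> ('a \<times> int) list \<Rightarrow> ('a \<times> int) list list" where
  "goal_words [] acc = [acc]"
| "goal_words (g # gs) acc =
     concat (map (\<lambda>w. goal_words gs (shift_word (snd g) w @ acc)) (words (fst g)))"

lemma goal_words_simps:
  "goal_words ((Leaf x, k) # gs) acc = goal_words gs ((x, k + 1) # acc)"
  "goal_words ((Moved j t, k) # gs) acc = goal_words ((t, k + j) # gs) acc"
  "goal_words ((Alt a b, k) # gs) acc = goal_words ((a, k) # gs) acc @ goal_words ((b, k) # gs) acc"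
  "goal_words ((Cat a b, k) # gs) acc = goal_words ((b, k) # (a, k) # gs) acc"
proof -
  have "concat (map f (map (\<lambda>(w, u). u @ w) (List.product ys xs)))
      = concat (map (\<lambda>w. concat (map (\<lambda>u. f (u @ w)) xs)) ys)"
    for f :: "('a \<times> int) list \<Rightarrow> ('a \<times> int) list list" and xs ys
    by (induction ys) (simp_all add: comp_def)
  from this[of "\<lambda>w. goal_words gs (shift_word k w @ acc)" "words b" "words a"]
  show "goal_words ((Cat a b, k) # gs) acc = goal_words ((b, k) # (a, k) # gs) acc"
    by simp
qed (simp_all add: comp_def add.commute)

primrec choice_words ::
  "(('a tree \<times> int) list \<times> ('a \<times> int) list) list \<Rightarrow> ('a \<times> int) list list" where
  "choice_words [] = []"
| "choice_words (c # cs) = goal_words (fst c) (snd c) @ choice_words cs"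

text \<open>Confining the unfolding to cells below \<open>M 0\<close> keeps it out of reach of the
  enumeration, which writes from there on.\<close>

primrec tree_at :: "(int \<Rightarrow> int) \<Rightarrow> int \<Rightarrow> int tree \<Rightarrow> bool" where
  "tree_at M a (Leaf x) \<longleftrightarrow> 0 < a \<and> a + 4 \<le> M 0 \<and> M a = 0 \<and> M (a + 1) = x"
| "tree_at M a (Moved k t) \<longleftrightarrow> 0 < a \<and> a + 4 \<le> M 0 \<and> M a = 3 \<and> M (a + 1) = k \<and> tree_at M (M (a + 2)) t"
| "tree_at M a (Alt t u) \<longleftrightarrow> 0 < a \<and> a + 4 \<le> M 0 \<and> M a = 2 \<and> tree_at M (M (a + 2)) t \<and>
     tree_at M (M (a + 3)) u"
| "tree_at M a (Cat t u) \<longleftrightarrow> 0 < a \<and> a + 4 \<le> M 0 \<and> M a = 1 \<and> tree_at M (M (a + 2)) t \<and>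
     tree_at M (M (a + 3)) u"

text \<open>Unambiguity read as injectivity of concatenation, which keeps the words of a
  \<open>Cat\<close> distinct.\<close>

lemma unambiguous_inj_on:
  assumes "unambiguous A B"
  shows "inj_on (\<lambda>(w, u). u @ w) (B \<times> A)"
proof (rule inj_onI, clarify)
  fix w u w' u'
  assume m: "w \<in> B" "u \<in> A" "w' \<in> B" "u' \<in> A" and eq: "u @ w = u' @ w'"
  then have "u @ w \<in> conc A B"
    by (auto simp: conc_def)
  then have "\<exists>!p. fst p \<in> A \<and> snd p \<in> B \<and> u @ w = fst p @ snd p"
    using assms by (simp add: unambiguous_def)
  then have "(u, w) = (u', w')"
    using m eq by (metis (no_types, lifting) fst_conv snd_conv)
  then show "w = w' \<and> u = u'"
    by simp
qed

text \<open>Acyclicity makes the unfolding finite, although the loss of sharing may blow it up; it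
  serves the proof only. The tree is fixed before \<open>enc\<close>, \<open>addr\<close> and
  \<open>M\<close>, since it depends on the structure alone.\<close>

lemma node_tree:
  assumes "tame D"
  shows "v \<in> nodes D \<Longrightarrow> \<exists>t. distinct (words t) \<and> set (words t) = den D v \<and> depth t = odepth D v \<and>
    shallow t \<and> (\<forall>enc addr M. stores enc addr D M \<longrightarrow> tree_at M (addr v) (map_tree enc t))"
    (is "_ \<Longrightarrow> \<exists>t. ?P v t")
proof (induction v rule: wf_induct_rule[OF shift_ecs_wf[OF tame_shift_ecs[OF assms]]])
  case (1 v)
  note sD = tame_shift_ecs[OF assms] and v = 1(2)
  have IH: "\<exists>t. ?P u t" if "left D v = Some u \<or> right D v = Some u" "u \<in> nodes D" for u
    using 1(1)[of u] that by (simp add: children_def)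
  have deep: "odepth D v \<le> 4"
    using assms v by (simp add: tame_def)
  show ?case
  proof (cases "lab D v")
    case (LBottom x)
    then have "?P v (Leaf x)"
      using den_simp[OF sD v] odepth_simp[OF sD v] v
      by (auto simp: stores_nodeD[OF _ v] output_node_lab)
    then show ?thesis ..
  next
    case (LShift k)
    obtain u where u: "left D v = Some u" "u \<in> nodes D"
      using node_children(1)[OF sD v LShift] by blast
    obtain t where t: "?P u t"
      using IH[of u] u by blast
    have "\<not> output_node D v"
      using LShift by (auto simp: output_node_lab)
    then have d: "odepth D v = Suc (odepth D u)"
      using odepth_simp[OF sD v] u by simp
    have "inj (shift_word k :: ('a \<times> int) list \<Rightarrow> _)"
      unfolding shift_word_def by (rule inj_mapI) (auto simp: inj_on_def)
    then have "distinct (words (Moved k t))"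
      using t by (simp add: distinct_map inj_on_subset[OF _ subset_UNIV])
    moreover have "set (words (Moved k t)) = den D v"
      using den_shift[OF sD v LShift] t u by (simp add: sh_def shift_word_def)
    moreover have "tree_at M (addr v) (map_tree enc (Moved k t))" if "stores enc addr D M" for enc addr M
      using stores_nodeD[OF that v] t that u LShift by simp
    moreover have "depth (Moved k t) = odepth D v \<and> shallow (Moved k t)"
      using t d deep by simp
    ultimately have "?P v (Moved k t)"
      by blast
    then show ?thesis ..
  next
    case LUnion
    obtain u w where u: "left D v = Some u" "u \<in> nodes D" "right D v = Some w" "w \<in> nodes D"
      using node_children(2)[OF sD v LUnion] by blast
    obtain a b where a: "?P u a" and b: "?P w b"
      using IH[of u] IH[of w] u by blast
    have "\<not> output_node D v"
      using LUnion by (auto simp: output_node_lab)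
    then have d: "odepth D v = Suc (odepth D u)"
      using odepth_simp[OF sD v] u by simp
    have "den D (lchild D v) \<inter> den D (rchild D v) = {}"
      using assms v LUnion by (simp add: tame_def)
    then have "distinct (words (Alt a b))"
      using a b u by simp
    moreover have "set (words (Alt a b)) = den D v"
      using den_simp[OF sD v] LUnion a b u by simp
    moreover have "tree_at M (addr v) (map_tree enc (Alt a b))" if "stores enc addr D M" for enc addr M
      using stores_nodeD[OF that v] a b that u LUnion by simp
    moreover have "depth (Alt a b) = odepth D v \<and> shallow (Alt a b)"
      using a b d deep by simp
    ultimately have "?P v (Alt a b)"
      by blast
    then show ?thesis ..
  next
    case LProd
    obtain u w where u: "left D v = Some u" "u \<in> nodes D" "right D v = Some w" "w \<in> nodes D"
      using node_children(3)[OF sD v LProd] by blast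
    obtain a b where a: "?P u a" and b: "?P w b"
      using IH[of u] IH[of w] u by blast
    have "output_node D v"
      using LProd v by (simp add: output_node_lab)
    then have d: "odepth D v = 0"
      using odepth_simp[OF sD v] by simp
    have "unambiguous (den D (lchild D v)) (den D (rchild D v))"
      using assms v LProd by (simp add: tame_def)
    then have "inj_on (\<lambda>(w, u). u @ w) (set (words b) \<times> set (words a))"
      using unambiguous_inj_on[of "den D u" "den D w"] a b u by simp
    then have "distinct (words (Cat a b))"
      using a b by (simp add: distinct_map distinct_product)
    moreover have "set (words (Cat a b)) = den D v"
      using den_simp[OF sD v] LProd a b u by (auto simp: conc_def image_iff)
    moreover have "tree_at M (addr v) (map_tree enc (Cat a b))" if "stores enc addr D M" for enc addr M
      using stores_nodeD[OF that v] a b that u LProd by simp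
    moreover have "depth (Cat a b) = odepth D v \<and> shallow (Cat a b)"
      using a b d by simp
    ultimately have "?P v (Cat a b)"
      by blast
    then show ?thesis ..
  qed
qed

section \<open>The enumeration program and its invariants\<close>

definition write_triple :: "nat \<Rightarrow> nat \<Rightarrow> nat \<Rightarrow> program" where
  "write_triple a b c = [Store 5 a, Plus 5 5 6, Store 5 b, Plus 5 5 6, Store 5 c, Plus 5 5 6]"

text \<open>Registers: 0 and 1 the node to expand and its accumulated shift, 2 the stack of goals still
  to be expanded, 3 the suffix of the current word built so far, 4 the stack of suspended
  alternatives, 5 the first free address, 6 the constant 1. Stacks and words are linked lists of
  triples whose last component points to the tail, with 0 for the empty list; since no triple is
  ever overwritten, a suspended alternative shares its goals and its suffix with the rest.
  The entry points are: 7 expand, 22 union, 39 product, 49 bottom, 59 next goal, 65 write the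
  word, 74 resume an alternative.\<close>

definition enum_prog :: program where
  "enum_prog =
    [Const 6 1, Const 7 0, Load 5 7, Const 1 0, Const 2 0, Const 3 0, Const 4 0] @
    [Load 7 0, Plus 8 0 6, Load 9 8, Plus 8 8 6, Load 10 8, Plus 8 8 6, Load 11 8,
     JumpZero 7 49, Minus 7 7 6, JumpZero 7 39, Minus 7 7 6, JumpZero 7 22,
     Plus 1 1 9, Move 0 10, Jump 7] @
    [Move 8 5] @ write_triple 11 1 2 @ [Move 9 5] @ write_triple 8 3 4 @
    [Move 4 9, Move 0 10, Jump 7] @
    [Move 8 5] @ write_triple 10 1 2 @ [Move 2 8, Move 0 11, Jump 7] @
    [Plus 7 1 6, Move 8 5] @ write_triple 9 7 3 @ [Move 3 8, JumpZero 2 65] @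
    [Load 0 2, Plus 8 2 6, Load 1 8, Plus 8 8 6, Load 2 8, Jump 7] @
    [Load 7 3, Plus 8 3 6, Load 9 8, Write 7 9, Plus 8 8 6, Load 3 8, JumpZero 3 73, Jump 65] @
    [Flush, JumpZero 4 81, Load 2 4, Plus 7 4 6, Load 3 7, Plus 7 7 6, Load 4 7, Jump 59]"

text \<open>Two memories: trees are read in the initial \<open>M\<close>, which the run leaves
  intact below \<open>M 0\<close>, and the stack in the current \<open>m\<close>. A write thus never
  affects the statements about trees.\<close>

primrec goals_at :: "(int \<Rightarrow> int) \<Rightarrow> (int \<Rightarrow> int) \<Rightarrow> int \<Rightarrow> int \<Rightarrow> (int tree \<times> int) list \<Rightarrow> bool" where
  "goals_at M m F p [] \<longleftrightarrow> p = 0"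
| "goals_at M m F p (g # gs) \<longleftrightarrow> 0 < p \<and> p + 3 \<le> F \<and> tree_at M (m p) (fst g) \<and> m (p + 1) = snd g \<and>
     goals_at M m F (m (p + 2)) gs"

primrec word_at :: "(int \<Rightarrow> int) \<Rightarrow> int \<Rightarrow> int \<Rightarrow> (int \<times> int) list \<Rightarrow> bool" where
  "word_at m F p [] \<longleftrightarrow> p = 0"
| "word_at m F p (x # w) \<longleftrightarrow> 0 < p \<and> p + 3 \<le> F \<and> m p = fst x \<and> m (p + 1) = snd x \<and>
     word_at m F (m (p + 2)) w"

text \<open>A choice is suspended with at least one goal, its right alternative, so resuming may
  fetch the next goal without testing for the empty stack.\<close>

primrec choices_at :: "(int \<Rightarrow> int) \<Rightarrow> (int \<Rightarrow> int) \<Rightarrow> int \<Rightarrow> int \<Rightarrow>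
  ((int tree \<times> int) list \<times> (int \<times> int) list) list \<Rightarrow> bool" where
  "choices_at M m F p [] \<longleftrightarrow> p = 0"
| "choices_at M m F p (c # cs) \<longleftrightarrow> 0 < p \<and> p + 3 \<le> F \<and> fst c \<noteq> [] \<and>
     goals_at M m F (m p) (fst c) \<and> word_at m F (m (p + 1)) (snd c) \<and>
     choices_at M m F (m (p + 2)) cs"

text \<open>Why sharing is harmless: all writes go to addresses from the frontier \<open>F\<close>
  on, so lists below it survive, however many stacks point to them.\<close>

lemma goals_at_frame:
  assumes "\<And>a. a < F \<Longrightarrow> m' a = m a" "F \<le> F'"
  shows "goals_at M m F p gs \<Longrightarrow> goals_at M m' F' p gs"
  using assms(2) by (induction gs arbitrary: p) (auto simp: assms(1))

lemma word_at_frame: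
  assumes "\<And>a. a < F \<Longrightarrow> m' a = m a" "F \<le> F'"
  shows "word_at m F p w \<Longrightarrow> word_at m' F' p w"
  using assms(2) by (induction w arbitrary: p) (auto simp: assms(1))

lemma choices_at_frame:
  assumes "\<And>a. a < F \<Longrightarrow> m' a = m a" "F \<le> F'"
  shows "choices_at M m F p cs \<Longrightarrow> choices_at M m' F' p cs"
  using assms(2) goals_at_frame[OF assms] word_at_frame[OF assms]
  by (induction cs arbitrary: p) (auto simp: assms(1))

definition all_shallow :: "('a tree \<times> int) list \<Rightarrow> bool" where
  "all_shallow gs \<longleftrightarrow> (\<forall>g\<in>set gs. shallow (fst g))"

definition config :: "(int \<Rightarrow> int) \<Rightarrow> state \<Rightarrow> (int tree \<times> int) list \<Rightarrow> (int \<times> int) list \<Rightarrow>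
  ((int tree \<times> int) list \<times> (int \<times> int) list) list \<Rightarrow> bool" where
  "config M s gs acc cs \<longleftrightarrow> 0 < M 0 \<and> M 0 \<le> regs s 5 \<and> regs s 6 = 1 \<and> buf s = [] \<and>
     (\<forall>a < M 0. mem s a = M a) \<and> goals_at M (mem s) (regs s 5) (regs s 2) gs \<and>
     word_at (mem s) (regs s 5) (regs s 3) acc \<and> choices_at M (mem s) (regs s 5) (regs s 4) cs \<and>
     all_shallow gs \<and> (\<forall>c\<in>set cs. all_shallow (fst c))"

definition expanding :: "(int \<Rightarrow> int) \<Rightarrow> state \<Rightarrow> int tree \<Rightarrow> int \<Rightarrow> (int tree \<times> int) list \<Rightarrow>
  (int \<times> int) list \<Rightarrow> ((int tree \<times> int) list \<times> (int \<times> int) list) list \<Rightarrow> bool" where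
  "expanding M s t k gs acc cs \<longleftrightarrow> pc s = 7 \<and> tree_at M (regs s 0) t \<and> shallow t \<and> regs s 1 = k \<and>
     config M s gs acc cs"

lemmas simulate_enum = run_numeral run_Suc step_def halted_def write_triple_def enum_prog_def

text \<open>The step counts of the blocks are exact, since the machine does not halt between them;
  the longest, 29 for a union, becomes the factor in \<open>expand_first\<close>.\<close>

lemma enum_shift:
  assumes "pc s = 7" "regs s 6 = 1" "mem s (regs s 0) = 3"
  shows "\<exists>R. run enum_prog 15 s = s\<lparr>pc := 7, regs := R\<rparr> \<and>
    R 0 = mem s (regs s 0 + 2) \<and> R 1 = regs s 1 + mem s (regs s 0 + 1) \<and> R 2 = regs s 2 \<and>
    R 3 = regs s 3 \<and> R 4 = regs s 4 \<and> R 5 = regs s 5 \<and> R 6 = 1"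
  using assms by (cases s) (simp add: simulate_enum add.commute)

lemma enum_union:
  assumes "pc s = 7" "regs s 6 = 1" "mem s (regs s 0) = 2"
  shows "\<exists>R. run enum_prog 29 s = s\<lparr>pc := 7, regs := R, mem := (mem s)
      (regs s 5 := mem s (regs s 0 + 3), regs s 5 + 1 := regs s 1, regs s 5 + 2 := regs s 2,
       regs s 5 + 3 := regs s 5, regs s 5 + 4 := regs s 3, regs s 5 + 5 := regs s 4)\<rparr> \<and>
    R 0 = mem s (regs s 0 + 2) \<and> R 1 = regs s 1 \<and> R 2 = regs s 2 \<and>
    R 3 = regs s 3 \<and> R 4 = regs s 5 + 3 \<and> R 5 = regs s 5 + 6 \<and> R 6 = 1"
  using assms by (cases s) (simp add: simulate_enum add.commute)

lemma enum_prod: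
  assumes "pc s = 7" "regs s 6 = 1" "mem s (regs s 0) = 1"
  shows "\<exists>R. run enum_prog 20 s = s\<lparr>pc := 7, regs := R, mem := (mem s)
      (regs s 5 := mem s (regs s 0 + 2), regs s 5 + 1 := regs s 1, regs s 5 + 2 := regs s 2)\<rparr> \<and>
    R 0 = mem s (regs s 0 + 3) \<and> R 1 = regs s 1 \<and> R 2 = regs s 5 \<and>
    R 3 = regs s 3 \<and> R 4 = regs s 4 \<and> R 5 = regs s 5 + 3 \<and> R 6 = 1"
  using assms by (cases s) (simp add: simulate_enum add.commute)

lemma enum_bottom:
  assumes "pc s = 7" "regs s 6 = 1" "mem s (regs s 0) = 0"
  shows "\<exists>R. run enum_prog 18 s = s\<lparr>pc := (if regs s 2 = 0 then 65 else 59), regs := R, mem := (mem s)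
      (regs s 5 := mem s (regs s 0 + 1), regs s 5 + 1 := regs s 1 + 1, regs s 5 + 2 := regs s 3)\<rparr> \<and>
    R 2 = regs s 2 \<and> R 3 = regs s 5 \<and> R 4 = regs s 4 \<and> R 5 = regs s 5 + 3 \<and> R 6 = 1"
  using assms by (cases s) (simp add: simulate_enum add.commute)

lemma enum_next_goal:
  assumes "pc s = 59" "regs s 6 = 1"
  shows "\<exists>R. run enum_prog 6 s = s\<lparr>pc := 7, regs := R\<rparr> \<and>
    R 0 = mem s (regs s 2) \<and> R 1 = mem s (regs s 2 + 1) \<and> R 2 = mem s (regs s 2 + 2) \<and>
    R 3 = regs s 3 \<and> R 4 = regs s 4 \<and> R 5 = regs s 5 \<and> R 6 = 1"
  using assms by (cases s) (simp add: simulate_enum add.commute)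

lemma enum_resume:
  assumes "pc s = 74" "regs s 6 = 1" "regs s 4 \<noteq> 0"
  shows "\<exists>R. run enum_prog 7 s = s\<lparr>pc := 59, regs := R\<rparr> \<and>
    R 2 = mem s (regs s 4) \<and> R 3 = mem s (regs s 4 + 1) \<and> R 4 = mem s (regs s 4 + 2) \<and>
    R 5 = regs s 5 \<and> R 6 = 1"
  using assms by (cases s) (simp add: simulate_enum add.commute)

lemma enum_write:
  assumes "pc s = 65" "regs s 6 = 1"
  shows "\<exists>R. run enum_prog 7 s = s\<lparr>pc := (if mem s (regs s 3 + 2) = 0 then 73 else 72), regs := R,
      buf := buf s @ [(mem s (regs s 3), mem s (regs s 3 + 1))]\<rparr> \<and>
    R 2 = regs s 2 \<and> R 3 = mem s (regs s 3 + 2) \<and> R 4 = regs s 4 \<and> R 5 = regs s 5 \<and> R 6 = 1"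
  using assms by (cases s) (simp add: simulate_enum add.commute)

lemma enum_jump: "pc s = 72 \<Longrightarrow> run enum_prog (Suc 0) s = s\<lparr>pc := 65\<rparr>"
  by (simp add: simulate_enum)

lemma enum_flush:
  "pc s = 73 \<Longrightarrow> run enum_prog (Suc 0) s = s\<lparr>pc := 74, buf := [], outs := outs s @ [buf s]\<rparr>"
  by (simp add: simulate_enum)

lemma enum_stop: "pc s = 74 \<Longrightarrow> regs s 4 = 0 \<Longrightarrow> run enum_prog (Suc 0) s = s\<lparr>pc := 81\<rparr>"
  by (simp add: simulate_enum)

lemma enum_init:
  "\<exists>R'. run enum_prog 7 (start R M) = \<lparr>pc = 7, regs = R', mem = M, buf = [], outs = []\<rparr> \<and>
    R' 0 = R 0 \<and> R' 1 = 0 \<and> R' 2 = 0 \<and> R' 3 = 0 \<and> R' 4 = 0 \<and> R' 5 = M 0 \<and> R' 6 = 1"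
  by (simp add: simulate_enum start_def)

lemma next_goal:
  assumes "pc s = 59" "config M s (g # gs) acc cs"
  shows "\<exists>s'. run enum_prog 6 s = s' \<and> expanding M s' (fst g) (snd g) gs acc cs \<and> outs s' = outs s"
proof -
  have "regs s 6 = 1"
    using assms by (simp add: config_def)
  from enum_next_goal[OF assms(1) this] show ?thesis
    using assms by (auto simp: config_def expanding_def all_shallow_def)
qed

lemma expand_shift:
  assumes "expanding M s (Moved j t) k gs acc cs"
  shows "\<exists>s'. run enum_prog 15 s = s' \<and> expanding M s' t (k + j) gs acc cs \<and> outs s' = outs s"
proof -
  have s: "pc s = 7" "regs s 6 = 1" "mem s (regs s 0) = 3" "mem s (regs s 0 + 1) = j"
      "mem s (regs s 0 + 2) = M (regs s 0 + 2)"
    using assms by (auto simp: config_def expanding_def)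
  from enum_shift[OF s(1-3)] show ?thesis
    using assms s by (auto simp: config_def expanding_def)
qed

lemma expand_union:
  assumes "expanding M s (Alt t u) k gs acc cs"
  shows "\<exists>s'. run enum_prog 29 s = s' \<and> expanding M s' t k gs acc (((u, k) # gs, acc) # cs) \<and>
    outs s' = outs s"
proof -
  let ?F = "regs s 5"
  have s: "pc s = 7" "regs s 6 = 1" "mem s (regs s 0) = 2"
      "mem s (regs s 0 + 2) = M (regs s 0 + 2)" "mem s (regs s 0 + 3) = M (regs s 0 + 3)"
    using assms by (auto simp: config_def expanding_def)
  obtain R where R: "run enum_prog 29 s = s\<lparr>pc := 7, regs := R, mem := (mem s)
      (?F := mem s (regs s 0 + 3), ?F + 1 := regs s 1, ?F + 2 := regs s 2,
       ?F + 3 := ?F, ?F + 4 := regs s 3, ?F + 5 := regs s 4)\<rparr>"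
    "R 0 = mem s (regs s 0 + 2)" "R 1 = regs s 1" "R 2 = regs s 2"
    "R 3 = regs s 3" "R 4 = ?F + 3" "R 5 = ?F + 6" "R 6 = 1"
    using enum_union[OF s(1-3)] by blast
  \<comment> \<open>Two triples: at \<open>?F\<close> the goals headed by the right alternative, at
    \<open>?F + 3\<close> the choice that points to them.\<close>
  define m' where "m' = (mem s)
      (?F := mem s (regs s 0 + 3), ?F + 1 := regs s 1, ?F + 2 := regs s 2,
       ?F + 3 := ?F, ?F + 4 := regs s 3, ?F + 5 := regs s 4)"
  have agree: "m' a = mem s a" if "a < ?F" for a
    using that by (simp add: m'_def)
  have le: "?F \<le> ?F + 6"
    by simp
  note frame = goals_at_frame[OF agree le] word_at_frame[OF agree le] choices_at_frame[OF agree le]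
  have cells: "m' ?F = M (regs s 0 + 3)" "m' (?F + 1) = regs s 1" "m' (?F + 2) = regs s 2"
    "m' (?F + 3) = ?F" "m' (?F + 3 + 1) = regs s 3" "m' (?F + 3 + 2) = regs s 4"
    using s by (simp_all add: m'_def add.assoc)
  have r: "run enum_prog 29 s = s\<lparr>pc := 7, regs := R, mem := m'\<rparr>"
    using R(1) by (simp add: m'_def)
  have "expanding M (run enum_prog 29 s) t k gs acc (((u, k) # gs, acc) # cs)"
    unfolding r using assms agree R(2-) s cells
    by (auto simp: config_def expanding_def all_shallow_def intro: frame)
  then show ?thesis
    using r by simp
qed

lemma expand_prod:
  assumes "expanding M s (Cat t u) k gs acc cs"
  shows "\<exists>s'. run enum_prog 20 s = s' \<and> expanding M s' u k ((t, k) # gs) acc cs \<and> outs s' = outs s"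
proof -
  let ?F = "regs s 5"
  have s: "pc s = 7" "regs s 6 = 1" "mem s (regs s 0) = 1"
      "mem s (regs s 0 + 2) = M (regs s 0 + 2)" "mem s (regs s 0 + 3) = M (regs s 0 + 3)"
    using assms by (auto simp: config_def expanding_def)
  obtain R where R: "run enum_prog 20 s = s\<lparr>pc := 7, regs := R, mem := (mem s)
      (?F := mem s (regs s 0 + 2), ?F + 1 := regs s 1, ?F + 2 := regs s 2)\<rparr>"
    "R 0 = mem s (regs s 0 + 3)" "R 1 = regs s 1" "R 2 = ?F"
    "R 3 = regs s 3" "R 4 = regs s 4" "R 5 = ?F + 3" "R 6 = 1"
    using enum_prod[OF s(1-3)] by blast
  define m' where "m' = (mem s)
      (?F := mem s (regs s 0 + 2), ?F + 1 := regs s 1, ?F + 2 := regs s 2)"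
  have agree: "m' a = mem s a" if "a < ?F" for a
    using that by (simp add: m'_def)
  have le: "?F \<le> ?F + 3"
    by simp
  note frame = goals_at_frame[OF agree le] word_at_frame[OF agree le] choices_at_frame[OF agree le]
  have cells: "m' ?F = M (regs s 0 + 2)" "m' (?F + 1) = regs s 1" "m' (?F + 2) = regs s 2"
    using s by (simp_all add: m'_def)
  have r: "run enum_prog 20 s = s\<lparr>pc := 7, regs := R, mem := m'\<rparr>"
    using R(1) by (simp add: m'_def)
  have "expanding M (run enum_prog 20 s) u k ((t, k) # gs) acc cs"
    unfolding r using assms agree R(2-) s cells
    by (auto simp: config_def expanding_def all_shallow_def intro: frame)
  then show ?thesis
    using r by simp
qed

lemma expand_bottom:
  assumes "expanding M s (Leaf x) k gs acc cs"
  shows "\<exists>s'. run enum_prog 18 s = s' \<and> pc s' = (if gs = [] then 65 else 59) \<and>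
    config M s' gs ((x, k + 1) # acc) cs \<and> outs s' = outs s"
proof -
  let ?F = "regs s 5"
  have s: "pc s = 7" "regs s 6 = 1" "mem s (regs s 0) = 0" "mem s (regs s 0 + 1) = x"
    using assms by (auto simp: config_def expanding_def)
  obtain R where R: "run enum_prog 18 s = s\<lparr>pc := (if regs s 2 = 0 then 65 else 59), regs := R,
      mem := (mem s)(?F := mem s (regs s 0 + 1), ?F + 1 := regs s 1 + 1, ?F + 2 := regs s 3)\<rparr>"
    "R 2 = regs s 2" "R 3 = ?F" "R 4 = regs s 4" "R 5 = ?F + 3" "R 6 = 1"
    using enum_bottom[OF s(1-3)] by blast
  define m' where "m' = (mem s)
      (?F := mem s (regs s 0 + 1), ?F + 1 := regs s 1 + 1, ?F + 2 := regs s 3)"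
  have agree: "m' a = mem s a" if "a < ?F" for a
    using that by (simp add: m'_def)
  have le: "?F \<le> ?F + 3"
    by simp
  note frame = goals_at_frame[OF agree le] word_at_frame[OF agree le] choices_at_frame[OF agree le]
  have cells: "m' ?F = x" "m' (?F + 1) = regs s 1 + 1" "m' (?F + 2) = regs s 3"
    using s by (simp_all add: m'_def)
  have "regs s 2 = 0 \<longleftrightarrow> gs = []"
    using assms by (cases gs) (auto simp: config_def expanding_def)
  then have r: "run enum_prog 18 s = s\<lparr>pc := (if gs = [] then 65 else 59), regs := R, mem := m'\<rparr>"
    using R(1) by (simp add: m'_def)
  have "config M (run enum_prog 18 s) gs ((x, k + 1) # acc) cs"
    unfolding r using assms agree R(2-) s cells
    by (auto simp: config_def expanding_def intro: frame)
  then show ?thesis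
    using r by simp
qed

text \<open>A letter takes 7 steps and a jump back, except that the last one goes straight to the
  flush; the strict bound leaves room for the flush itself.\<close>

lemma write_word:
  assumes "pc s = 65" "regs s 6 = 1" "word_at (mem s) (regs s 5) (regs s 3) w" "w \<noteq> []"
  shows "\<exists>n R. run enum_prog n s = s\<lparr>pc := 73, regs := R, buf := buf s @ w\<rparr> \<and> n < 8 * length w \<and>
    R 2 = regs s 2 \<and> R 3 = 0 \<and> R 4 = regs s 4 \<and> R 5 = regs s 5 \<and> R 6 = 1"
  using assms
proof (induction w arbitrary: s)
  case (Cons x w)
  obtain R where R: "run enum_prog 7 s = s\<lparr>pc := (if mem s (regs s 3 + 2) = 0 then 73 else 72), regs := R,
      buf := buf s @ [(mem s (regs s 3), mem s (regs s 3 + 1))]\<rparr>"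
    "R 2 = regs s 2" "R 3 = mem s (regs s 3 + 2)" "R 4 = regs s 4" "R 5 = regs s 5" "R 6 = 1"
    using enum_write[OF Cons.prems(1,2)] by blast
  have x: "(mem s (regs s 3), mem s (regs s 3 + 1)) = x"
    using Cons.prems by simp
  show ?case
  proof (cases "w = []")
    case True
    then show ?thesis
      using R x Cons.prems by (intro exI[of _ 7] exI[of _ R]) simp
  next
    case False
    let ?s = "s\<lparr>pc := 65, regs := R, buf := buf s @ [x]\<rparr>"
    have "mem s (regs s 3 + 2) \<noteq> 0"
      using Cons.prems False by (cases w) auto
    then have "run enum_prog (7 + Suc 0) s = ?s"
      unfolding run_add R(1) x by (subst enum_jump) simp_all
    moreover obtain n R' where "run enum_prog n ?s = ?s\<lparr>pc := 73, regs := R', buf := buf ?s @ w\<rparr>"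
      "n < 8 * length w" "R' 2 = regs ?s 2" "R' 3 = 0" "R' 4 = regs ?s 4" "R' 5 = regs ?s 5" "R' 6 = 1"
      using Cons.IH[of ?s] Cons.prems R False by auto
    ultimately show ?thesis
      using R by (intro exI[of _ "7 + Suc 0 + n"] exI[of _ R']) (simp add: run_add)
  qed
qed simp

lemma flush_word:
  assumes "pc s = 65" "config M s [] w cs" "w \<noteq> []"
  shows "\<exists>n. Suc n \<le> 8 * length w \<and> outs (run enum_prog n s) = outs s \<and>
    outs (run enum_prog (Suc n) s) = outs s @ [w] \<and> pc (run enum_prog (Suc n) s) = 74 \<and>
    config M (run enum_prog (Suc n) s) [] [] cs"
proof -
  have s: "regs s 6 = 1" "word_at (mem s) (regs s 5) (regs s 3) w" "buf s = []"
    using assms by (auto simp: config_def)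
  obtain n R where n: "run enum_prog n s = s\<lparr>pc := 73, regs := R, buf := buf s @ w\<rparr>"
    "n < 8 * length w" "R 2 = regs s 2" "R 3 = 0" "R 4 = regs s 4" "R 5 = regs s 5" "R 6 = 1"
    using write_word[OF assms(1) s(1,2) assms(3)] by blast
  have "run enum_prog (Suc n) s = run enum_prog (Suc 0) (run enum_prog n s)"
    using run_add[of enum_prog n "Suc 0" s] by simp
  also have "\<dots> = s\<lparr>pc := 74, regs := R, buf := [], outs := outs s @ [w]\<rparr>"
    unfolding n(1) by (subst enum_flush) (simp_all add: s(3))
  finally show ?thesis
    using n assms(2) by (intro exI[of _ n]) (auto simp: config_def)
qed

text \<open>Expansion always follows the left alternative, so it runs into the first word of the current
  goals and leaves exactly the remaining words to the suspended alternatives.\<close>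

lemma expand_first:
  assumes "expanding M s t k gs acc cs"
  shows "\<exists>n w cs'. pc (run enum_prog n s) = 65 \<and> config M (run enum_prog n s) [] w cs' \<and>
    outs (run enum_prog n s) = outs s \<and>
    goal_words ((t, k) # gs) acc @ choice_words cs = w # choice_words cs' \<and>
    n \<le> 29 * (first_steps t + (\<Sum>g\<leftarrow>gs. first_steps (fst g))) \<and>
    length w = length acc + first_length t + (\<Sum>g\<leftarrow>gs. first_length (fst g))"
  using assms
\<comment> \<open>The measure counts the nodes still to be expanded before the first word is
  complete; every transition removes exactly one, at a cost of at most 29 steps.\<close>
proof (induction "first_steps t + (\<Sum>g\<leftarrow>gs. first_steps (fst g))" arbitrary: s t k gs acc cs
    rule: less_induct)
  case less
  have combine: ?case
    if r: "run enum_prog n1 s = s1" and e: "expanding M s1 t1 k1 gs1 acc1 cs1" and o: "outs s1 = outs s"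
      and st: "Suc (first_steps t1 + (\<Sum>g\<leftarrow>gs1. first_steps (fst g))) =
        first_steps t + (\<Sum>g\<leftarrow>gs. first_steps (fst g))"
      and ln: "length acc1 + first_length t1 + (\<Sum>g\<leftarrow>gs1. first_length (fst g)) =
        length acc + first_length t + (\<Sum>g\<leftarrow>gs. first_length (fst g))"
      and w: "goal_words ((t, k) # gs) acc @ choice_words cs =
        goal_words ((t1, k1) # gs1) acc1 @ choice_words cs1"
      and n1: "n1 \<le> 29" for n1 s1 t1 k1 gs1 acc1 cs1
  proof -
    obtain n w cs' where n: "pc (run enum_prog n s1) = 65" "config M (run enum_prog n s1) [] w cs'"
      "outs (run enum_prog n s1) = outs s1"
      "goal_words ((t1, k1) # gs1) acc1 @ choice_words cs1 = w # choice_words cs'"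
      "n \<le> 29 * (first_steps t1 + (\<Sum>g\<leftarrow>gs1. first_steps (fst g)))"
      "length w = length acc1 + first_length t1 + (\<Sum>g\<leftarrow>gs1. first_length (fst g))"
      using less.hyps[OF _ e] st by auto
    have "n1 + n \<le> 29 * (first_steps t + (\<Sum>g\<leftarrow>gs. first_steps (fst g)))"
      using n(5) n1 unfolding st[symmetric] by simp
    then show ?thesis
      using n o ln w r
      by (intro exI[of _ "n1 + n"] exI[of _ w] exI[of _ cs']) (simp add: run_add)
  qed
  show ?case
  proof (cases t)
    case (Leaf x)
    obtain s1 where s1: "run enum_prog 18 s = s1" "pc s1 = (if gs = [] then 65 else 59)"
      "config M s1 gs ((x, k + 1) # acc) cs" "outs s1 = outs s"
      using expand_bottom less.prems Leaf by blast
    show ?thesis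
    proof (cases gs)
      case Nil
      then show ?thesis
        using s1 Leaf by (intro exI[of _ 18] exI[of _ "(x, k + 1) # acc"] exI[of _ cs])
          (simp add: goal_words_simps del: goal_words.simps(2))
    next
      case (Cons g gs')
      obtain s2 where s2: "run enum_prog 6 s1 = s2"
        "expanding M s2 (fst g) (snd g) gs' ((x, k + 1) # acc) cs" "outs s2 = outs s1"
        using next_goal[of s1 M g gs'] s1 Cons by auto
      have "run enum_prog (18 + 6) s = s2"
        unfolding run_add s1(1) s2(1) ..
      then show ?thesis
        by (rule combine[OF _ s2(2)])
          (use s1(4) s2(3) Cons Leaf in \<open>simp_all add: goal_words_simps(1) del: goal_words.simps(2)\<close>)
    qed
  next
    case (Moved j u)
    obtain s1 where s1: "run enum_prog 15 s = s1" "expanding M s1 u (k + j) gs acc cs" "outs s1 = outs s"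
      using expand_shift less.prems Moved by blast
    show ?thesis
      by (rule combine[OF s1])
        (use Moved in \<open>simp_all add: goal_words_simps(2) del: goal_words.simps(2)\<close>)
  next
    case (Alt a b)
    obtain s1 where s1: "run enum_prog 29 s = s1"
      "expanding M s1 a k gs acc (((b, k) # gs, acc) # cs)" "outs s1 = outs s"
      using expand_union less.prems Alt by blast
    show ?thesis
      by (rule combine[OF s1])
        (use Alt in \<open>simp_all add: goal_words_simps(3) del: goal_words.simps(2)\<close>)
  next
    case (Cat a b)
    obtain s1 where s1: "run enum_prog 20 s = s1" "expanding M s1 b k ((a, k) # gs) acc cs"
      "outs s1 = outs s"
      using expand_prod less.prems Cat by blast
    show ?thesis
      by (rule combine[OF s1])
        (use Cat in \<open>simp_all add: goal_words_simps(4) del: goal_words.simps(2)\<close>)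
  qed
qed

lemma first_length_pos: "0 < first_length t"
  by (induction t) auto

text \<open>298 = 290 + 8: \<open>first_steps_bound\<close> charges 10 expansions of at most 29
  steps to each letter, and writing costs 8 more per letter.\<close>

lemma next_word:
  assumes "expanding M s t k gs acc cs"
  shows "\<exists>n w cs'. Suc n \<le> 298 * length w \<and> 0 < length w \<and> outs (run enum_prog n s) = outs s \<and>
    outs (run enum_prog (Suc n) s) = outs s @ [w] \<and> pc (run enum_prog (Suc n) s) = 74 \<and>
    config M (run enum_prog (Suc n) s) [] [] cs' \<and>
    goal_words ((t, k) # gs) acc @ choice_words cs = w # choice_words cs'"
proof -
  obtain n w cs' where n: "pc (run enum_prog n s) = 65" "config M (run enum_prog n s) [] w cs'"
    "outs (run enum_prog n s) = outs s"
    "goal_words ((t, k) # gs) acc @ choice_words cs = w # choice_words cs'"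
    "n \<le> 29 * (first_steps t + (\<Sum>g\<leftarrow>gs. first_steps (fst g)))"
    "length w = length acc + first_length t + (\<Sum>g\<leftarrow>gs. first_length (fst g))"
    using expand_first[OF assms] by blast
  have sh: "shallow t" "all_shallow gs"
    using assms by (auto simp: expanding_def config_def)
  have "(\<Sum>g\<leftarrow>gs. first_steps (fst g)) \<le> 10 * (\<Sum>g\<leftarrow>gs. first_length (fst g))"
    using sh(2) by (induction gs) (auto simp: all_shallow_def dest!: first_steps_bound)
  then have n_le: "n \<le> 290 * length w"
    using n(5,6) first_steps_bound[OF sh(1)] by simp
  have w: "0 < length w"
    using n(6) first_length_pos[of t] by simp
  obtain n' where n': "Suc n' \<le> 8 * length w"
    "outs (run enum_prog n' (run enum_prog n s)) = outs s"
    "outs (run enum_prog (Suc n') (run enum_prog n s)) = outs s @ [w]"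
    "pc (run enum_prog (Suc n') (run enum_prog n s)) = 74"
    "config M (run enum_prog (Suc n') (run enum_prog n s)) [] [] cs'"
    using flush_word[OF n(1,2)] w n(3) by auto
  then show ?thesis
    using n(4) n_le w unfolding run_add[symmetric]
    by (intro exI[of _ "n + n'"] exI[of _ w] exI[of _ cs']) simp
qed

lemma resume_emits:
  assumes "pc s = 74" "config M s [] [] cs"
  shows "emits enum_prog 400 (\<lambda>m. \<forall>a < M 0. m a = M a) s (choice_words cs)"
  using assms
\<comment> \<open>Each round outputs one of the remaining words, whereas the list of choices itself
  may grow.\<close>
proof (induction "length (choice_words cs)" arbitrary: s cs rule: less_induct)
  case less
  show ?case
  proof (cases cs)
    case Nil
    then have "regs s 4 = 0"
      using less.prems by (simp add: config_def)
    then have "run enum_prog (Suc 0) s = s\<lparr>pc := 81\<rparr>"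
      using enum_stop less.prems by blast
    then have "emits enum_prog 400 (\<lambda>m. \<forall>a < M 0. m a = M a) s []"
      by (intro emits.stop[of _ "Suc 0"])
        (use less.prems in \<open>auto simp: config_def halted_def enum_prog_def write_triple_def\<close>)
    then show ?thesis
      using Nil by simp
  next
    case (Cons c cs1)
    obtain g gs acc where c: "c = (g # gs, acc)"
      using less.prems Cons by (cases c; cases "fst c") (auto simp: config_def)
    have s: "regs s 6 = 1" "regs s 4 \<noteq> 0"
      using less.prems Cons by (auto simp: config_def)
    have "\<exists>s1. run enum_prog 7 s = s1 \<and> pc s1 = 59 \<and> config M s1 (g # gs) acc cs1 \<and> outs s1 = outs s"
      using enum_resume[OF less.prems(1) s] less.prems(2) Cons c
      by (auto simp: config_def)
    then obtain s1 where s1: "run enum_prog 7 s = s1" "pc s1 = 59" "config M s1 (g # gs) acc cs1"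
      "outs s1 = outs s"
      by blast
    obtain s2 where s2: "run enum_prog 6 s1 = s2" "expanding M s2 (fst g) (snd g) gs acc cs1"
      "outs s2 = outs s1"
      using next_goal[OF s1(2,3)] by blast
    obtain n w cs' where n: "Suc n \<le> 298 * length w" "0 < length w" "outs (run enum_prog n s2) = outs s2"
      "outs (run enum_prog (Suc n) s2) = outs s2 @ [w]" "pc (run enum_prog (Suc n) s2) = 74"
      "config M (run enum_prog (Suc n) s2) [] [] cs'"
      "goal_words ((fst g, snd g) # gs) acc @ choice_words cs1 = w # choice_words cs'"
      using next_word[OF s2(2)] by blast
    have run: "run enum_prog (13 + m) s = run enum_prog m s2" for m
      using run_add[of enum_prog 7 "6 + m" s] run_add[of enum_prog 6 m s1] s1 s2 by simp
    have cw: "choice_words cs = w # choice_words cs'"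
      using n(7) Cons c by simp
    have "emits enum_prog 400 (\<lambda>m. \<forall>a < M 0. m a = M a) (run enum_prog (Suc n) s2) (choice_words cs')"
      using less.hyps[OF _ n(5,6)] cw by simp
    \<comment> \<open>Resuming takes 7 + 6 steps; as \<open>w\<close> is not empty, these are
      charged to its letters, and 298 + 13 stays below 400.\<close>
    moreover have "Suc (13 + n) \<le> 400 * length w"
      using n(1,2) by linarith
    ultimately have "emits enum_prog 400 (\<lambda>m. \<forall>a < M 0. m a = M a) s (w # choice_words cs')"
      using n(3,4) run[of n] run[of "Suc n"] s1(4) s2(3)
      by (intro emits.emit[of _ "13 + n"]) simp_all
    then show ?thesis
      using cw by simp
  qed
qed

text \<open>The first word is reached by a direct descent instead of a resumption; the 7 steps of
  initialisation are charged to it.\<close>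

lemma enum_prog_emits:
  assumes "tree_at M (R 0) t" "shallow t" "0 < M 0"
  shows "emits enum_prog 400 (\<lambda>m. \<forall>a < M 0. m a = M a) (start R M) (words t)"
proof -
  have "\<exists>s. run enum_prog 7 (start R M) = s \<and> expanding M s t 0 [] [] [] \<and> outs s = []"
    using enum_init[of R M] assms by (auto simp: expanding_def config_def all_shallow_def)
  then obtain s where s: "run enum_prog 7 (start R M) = s" "expanding M s t 0 [] [] []" "outs s = []"
    by blast
  obtain n w cs where n: "Suc n \<le> 298 * length w" "0 < length w" "outs (run enum_prog n s) = outs s"
    "outs (run enum_prog (Suc n) s) = outs s @ [w]" "pc (run enum_prog (Suc n) s) = 74"
    "config M (run enum_prog (Suc n) s) [] [] cs"
    "goal_words ((t, 0) # []) [] @ choice_words [] = w # choice_words cs"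
    using next_word[OF s(2)] by blast
  have run: "run enum_prog (7 + m) (start R M) = run enum_prog m s" for m
    using run_add[of enum_prog 7 m "start R M"] s by simp
  have words: "words t = w # choice_words cs"
    using n(7) by (simp add: shift_word_def)
  have "Suc (7 + n) \<le> 400 * length w"
    using n(1,2) by linarith
  moreover have "outs (start R M) = []"
    by (simp add: start_def)
  ultimately show ?thesis
    unfolding words using n(3,4) run[of n] run[of "Suc n"] s(3) resume_emits[OF n(5,6)]
    by (intro emits.emit[of _ "7 + n"]) simp_all
qed

text \<open>\<open>enc\<close> is injective on the alphabet only; that all letters lie in it is what
  keeps distinct words distinct under encoding.\<close>

lemma den_alphabet:
  assumes "shift_ecs D"
  shows "v \<in> nodes D \<Longrightarrow> den D v \<subseteq> lists (alphabet D \<times> UNIV)"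
proof (induction v rule: wf_induct_rule[OF shift_ecs_wf[OF assms]])
  case (1 v)
  have IH: "den D u \<subseteq> lists (alphabet D \<times> UNIV)"
    if "left D v = Some u \<or> right D v = Some u" "u \<in> nodes D" for u
    using 1(1)[of u] that by (simp add: children_def)
  have shift: "sh A k \<subseteq> lists (alphabet D \<times> UNIV)" if "A \<subseteq> lists (alphabet D \<times> UNIV)" for A k
    using that by (fastforce simp: sh_def)
  have conc: "conc A B \<subseteq> lists (alphabet D \<times> UNIV)"
    if "A \<subseteq> lists (alphabet D \<times> UNIV)" "B \<subseteq> lists (alphabet D \<times> UNIV)" for A B
    using that by (fastforce simp: conc_def)
  note v = node_children[OF assms 1(2)] and den = den_simp[OF assms 1(2)]
  show ?case
  proof (cases "lab D v")
    case (LBottom x)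
    then show ?thesis
      using v(4) den by simp
  next
    case (LShift k)
    obtain u where "left D v = Some u" "u \<in> nodes D"
      using v(1)[OF LShift] by blast
    then show ?thesis
      using den IH[of u] shift LShift by simp
  next
    case LUnion
    obtain u w where "left D v = Some u" "u \<in> nodes D" "right D v = Some w" "w \<in> nodes D"
      using v(2)[OF LUnion] by blast
    then show ?thesis
      using den IH[of u] IH[of w] LUnion by simp
  next
    case LProd
    obtain u w where "left D v = Some u" "u \<in> nodes D" "right D v = Some w" "w \<in> nodes D"
      using v(3)[OF LProd] by blast
    then show ?thesis
      using den IH[of u] IH[of w] conc LProd by simp
  qed
qed

lemma tame_enumerable:
  fixes D :: "('a, nat) ecs"
  assumes D: "tame D" and inj: "inj_on enc (alphabet D)" and v: "v \<in> nodes D"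
  shows "enumerable enc enum_prog 400 D v"
  unfolding enumerable_def
proof (intro allI impI)
  fix addr :: "nat \<Rightarrow> int" and M :: "int \<Rightarrow> int" and R :: "nat \<Rightarrow> int"
  assume asm: "stores enc addr D M \<and> R 0 = addr v"
  obtain t where t: "distinct (words t)" "set (words t) = den D v" "shallow t"
    "\<And>enc addr M. stores enc addr D M \<Longrightarrow> tree_at M (addr v) (map_tree enc t)"
    using node_tree[OF D v] by blast
  have words: "words (map_tree enc t) = map (encode_string enc) (words t)"
    by (simp add: words_map_tree encode_string_def[abs_def])
  have "inj_on (\<lambda>(x, i). (enc x, i)) (alphabet D \<times> (UNIV :: int set))"
    using inj by (auto simp: inj_on_def)
  moreover have "\<Union> (set ` lists S) \<subseteq> S" for S :: "('a \<times> int) set"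
    by (auto simp: lists_eq_set)
  ultimately have "inj_on (map (\<lambda>(x, i). (enc x, i))) (lists (alphabet D \<times> (UNIV :: int set)))"
    by (intro inj_on_mapI) (rule inj_on_subset)
  then have "inj_on (encode_string enc) (den D v)"
    unfolding encode_string_def[abs_def]
    by (rule inj_on_subset[OF _ den_alphabet[OF tame_shift_ecs[OF D] v]])
  then have dist: "distinct (words (map_tree enc t))"
    using t by (simp add: words distinct_map)
  have "emits enum_prog 400 (\<lambda>m. \<forall>a < M 0. m a = M a) (start R M) (words (map_tree enc t))"
    by (rule enum_prog_emits) (use asm t in \<open>auto simp: stores_def\<close>)
  note e = emits_enumerates[OF this dist]
  have "enumerates_output_linear enum_prog 400 (start R M) (encode_string enc ` den D v)"
    using e(1) t(2) by (simp add: words)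
  \<comment> \<open>Cell 0 and all cells of nodes lie below \<open>M 0\<close>, the range that the
    run leaves intact.\<close>
  moreover have "stores enc addr D (mem (run enum_prog n (start R M)))"
    if "halted enum_prog (run enum_prog n (start R M))" for n
    by (rule stores_frame) (use asm e(2)[OF that] in \<open>auto simp: stores_def\<close>)
  ultimately show "enumerates_output_linear enum_prog 400 (start R M) (encode_string enc ` den D v) \<and>
      (\<forall>n. halted enum_prog (run enum_prog n (start R M)) \<longrightarrow>
         stores enc addr D (mem (run enum_prog n (start R M))))"
    by blast
qed

theorem mainTheorem2:
  fixes \<Omega> :: "'o set" and enc :: "'o \<Rightarrow> int"
  assumes "finite \<Omega>" and "inj_on enc \<Omega>"
  shows "\<exists>(impl :: ('o, nat) ecs \<Rightarrow> ('o, nat) request \<Rightarrow> ('o, nat) ecs \<times> nat)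
           (prog :: kind \<Rightarrow> program) (enum :: program) (c :: nat).
     (\<forall>D q D' v'. shift_ecs D \<and> alphabet D = \<Omega> \<and> admissible D q \<and> impl D q = (D', v') \<longrightarrow>
        shift_ecs D' \<and> extends D D' \<and> v' \<in> nodes D' - nodes D \<and>
        den D' v' = result_set D q \<and>
        (\<forall>u \<in> nodes D. den D' u = den D u) \<and>
        performs enc (prog (kind_of q)) c D q D' v') \<and>
     (\<forall>D. safely_built impl \<Omega> D \<longrightarrow>
        (\<forall>q D' v'. admissible D q \<and> (\<forall>v \<in> arg_nodes q. safe D v) \<and> impl D q = (D', v') \<longrightarrow>
           safe D' v') \<and>
        (\<forall>v \<in> nodes D. enumerable enc enum c D v))"
\<comment> \<open>The enumeration's constant 400 also covers the 100 steps of an operation.\<close>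
proof (intro exI[of _ impl] exI[of _ op_prog] exI[of _ enum_prog] exI[of _ 400] conjI allI impI)
  fix D :: "('o, nat) ecs" and q D' v'
  assume asm: "shift_ecs D \<and> alphabet D = \<Omega> \<and> admissible D q \<and> impl D q = (D', v')"
  then have D: "shift_ecs D" and q: "well_formed D q" and eq: "impl D q = (D', v')"
    by (simp_all add: admissible_well_formed)
  note i = implements_impl[OF D q eq]
  from i show D': "shift_ecs D'" "extends D D'" and "v' \<in> nodes D' - nodes D"
      "den D' v' = result_set D q"
    by (simp_all add: implements_def)
  show "\<forall>u\<in>nodes D. den D' u = den D u"
    using extends_den[OF D D'] by simp
  show "performs enc (op_prog (kind_of q)) 400 D q D' v'"
    by (rule impl_performs[OF D q eq]) simp
next
  fix D :: "('o, nat) ecs" and q D' v'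
  assume D: "safely_built impl \<Omega> D"
    and asm: "admissible D q \<and> (\<forall>v\<in>arg_nodes q. safe D v) \<and> impl D q = (D', v')"
  have "tame D"
    using safely_built_tame[OF D] by simp
  then show "safe D' v'"
    using impl_safe[of D q D' v'] asm by simp
next
  fix D :: "('o, nat) ecs"
  assume D: "safely_built impl \<Omega> D"
  show "\<forall>v\<in>nodes D. enumerable enc enum_prog 400 D v"
    using safely_built_tame[OF D] tame_enumerable[of D enc] assms(2) by simp
qed

end
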